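(* Let $\mathcal{C}$ be a finitely complete category with a factorization system $(\mathcal{E},\mathcal{M})$ and a left arrow object $s,t:1\to 2$, satisfying Lawvere's axioms on $2$, $3$, $4$ (as specified in the context). For each $X\in\mathcal{C}$ let $X^\star\to\overline X$ be the functor sending a point $x$ to $\nu(x)$ and an arrow $l:x\Rightarrow y$ of $X$ to the arrow $\nu(x)\to\nu(y)$ of $\overline X$ corresponding to the displacement $u\circ s$, where $u$ is the lifting of $l$ to the final point of $\nu(y)$. Then the functors $X^\star\to\overline X$ are the components of a pseudo-natural transformation from $(-)^\star:\mathcal{C}\to\mathbf{Cat}$ to $\overline{(-)}:\mathcal{C}\to\mathbf{Cat}$.
   Context: Factorization systems. $\mathcal{C}$ has finite limits, with terminal object $1$. Write $e\perp m$ if for every commutative square $ge=mf$ there is a unique $u$ with $ue=f$ and $mu=g$. A factorization system $(\mathcal{E},\mathcal{M})$ consists of classes of arrows with $\mathcal{E}=\{e : e\perp m \text{ for all } m\in\mathcal{M}\}$, $\mathcal{M}=\{m : e\perp m\text{ for all } e\in\mathcal{E}\}$, such that every arrow factors as $m\circ e$ with $e\in\mathcal{E}$, $m\in\mathcal{M}$. Objects of $\mathcal{C}$ are called spaces, arrows are called maps. A map is final if it is in $\mathcal{E}$. A point of $X$ is a map $1\to X$. Neighborhoods and adherence. $\mathcal{M}/X$ is the full subcategory of $\mathcal{C}/X$ on the arrows in $\mathcal{M}$ (discrete spaces over $X$). It is reflective: if $p=m\circ e$ with $e\in\mathcal{E}$, $m\in\mathcal{M}$ is the (fixed) factorization of $p$,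 the reflection is $\downarrow p=m$ with reflection map $e:p\to m$. The neighborhood of a point $x$ of $X$ is $\nu(x)=\downarrow x$; its reflection map $e_x:x\to\nu(x)$ is a final point of the total space of $\nu(x)$, lying over $x$. The adherence category $\overline X$ is the full subcategory of $\mathcal{M}/X$ on the neighborhoods of the points of $X$. A displacement from $x$ to $y$ is a map $\lambda:x\to\nu(y)$ over $X$, i.e. a point $\lambda$ of the total of $\nu(y)$ with $\nu(y)\circ\lambda=x$; displacements correspond bijectively to arrows $\hat\lambda:\nu(x)\to\nu(y)$ of $\overline X$ via $\hat\lambda\circ e_x=\lambda$. For $f:X\to Y$, the functor $\exists_f:\mathcal{M}/X\to\mathcal{M}/Y$, $\exists_f m=\downarrow(f\circ m)$ (left adjoint to pullback along $f$) satisfies $\exists_f\nu(x)\cong\nu(f x)$ canonically, so it restricts to a functor $\overline f:\overline X\to\overline Y$; this makes $\overline{(-)}:\mathcal{C}\to\mathbf{Cat}$ a pseudo-functor. Arrow object. A left arrow object is an object $2$ with two points $s,t:1\to 2$ such that $t$ generates the factorization system: $\mathcal{M}=\{m: t\perp m\}$. An arrow $l:x\Rightarrow y$ of $X$ is a map $l:2\to X$ with $l s=x$ (domain) and $l t=y$ (codomain). The identity arrow at $x$ is the constant map $2\to1\xrightarrow{x}X$. For $m:M\to X$ in $\mathcal{M}$, an arrow $l:2\to X$ and a point $a$ of $M$ over $l t$, the lifting of $l$ to $a$ is the unique $u:2\to M$ with $m u=l$ and $u t=a$. Standing assumptions (Lawvere's axioms on $2,3,4$). There is a pushout $3$ of $1\xrightarrow{s}2$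 and $1\xrightarrow{t}2$, with maps $l_1,l_2:2\to3$ satisfying $l_1 t=l_2 s$; the non-identity arrows of $3$ are exactly three, $l_1:a\Rightarrow b$, $l_2:b\Rightarrow c$ and $l_3:a\Rightarrow c$. The composite of consecutive arrows $l:x\Rightarrow y$, $l':y\Rightarrow z$ of $X$ is $w\circ l_3:x\Rightarrow z$, where $w:3\to X$ is the unique map with $w l_1=l$, $w l_2=l'$. The axioms (including those on the pushout $4$ gluing three consecutive copies of $2$) ensure that this composition is associative and unital with respect to identity arrows, so that the points and arrows of $X$ form a category $X^\star$; each map $f:X\to Y$ induces by composition a functor $f^\star:X^\star\to Y^\star$, giving the functor $(-)^\star:\mathcal{C}\to\mathbf{Cat}$. *)

theory Defs
  imports Main
begin

section \<open>Categories, functors and natural isomorphisms\<close>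

text \<open>
  Composition is written in the order of application: \<open>g \<cdot>\<^bsub>C\<^esub> f\<close> is first \<open>f\<close>, then \<open>g\<close>.
  Nothing is assumed about the fields of the record outside the carriers.
\<close>

record ('o, 'a) cat =
  Obj  :: "'o set"
  Arr  :: "'a set"
  Dom  :: "'a \<Rightarrow> 'o"
  Cod  :: "'a \<Rightarrow> 'o"
  Ide  :: "'o \<Rightarrow> 'a"
  Comp :: "'a \<Rightarrow> 'a \<Rightarrow> 'a"  (infixr "\<cdot>\<index>" 70)

definition hom :: "('o, 'a, 'z) cat_scheme \<Rightarrow> 'o \<Rightarrow> 'o \<Rightarrow> 'a set" where
  "hom C x y = {f \<in> Arr C. Dom C f = x \<and> Cod C f = y}"

locale category =
  fixes C :: "('o, 'a, 'z) cat_scheme" (structure)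
  assumes dom_obj: "f \<in> Arr C \<Longrightarrow> Dom C f \<in> Obj C"
    and cod_obj: "f \<in> Arr C \<Longrightarrow> Cod C f \<in> Obj C"
    and ide_hom: "x \<in> Obj C \<Longrightarrow> Ide C x \<in> hom C x x"
    and comp_hom: "\<lbrakk>f \<in> hom C x y; g \<in> hom C y z\<rbrakk> \<Longrightarrow> g \<cdot> f \<in> hom C x z"
    and comp_ide: "f \<in> hom C x y \<Longrightarrow> f \<cdot> Ide C x = f"
    and ide_comp: "f \<in> hom C x y \<Longrightarrow> Ide C y \<cdot> f = f"
    and comp_assoc:
      "\<lbrakk>f \<in> hom C x y; g \<in> hom C y z; h \<in> hom C z w\<rbrakk> \<Longrightarrow> (h \<cdot> g) \<cdot> f = h \<cdot> (g \<cdot> f)"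

definition iso :: "('o, 'a, 'z) cat_scheme \<Rightarrow> 'a \<Rightarrow> bool" where
  "iso C f \<longleftrightarrow> f \<in> Arr C \<and>
     (\<exists>g \<in> hom C (Cod C f) (Dom C f).
        g \<cdot>\<^bsub>C\<^esub> f = Ide C (Dom C f) \<and> f \<cdot>\<^bsub>C\<^esub> g = Ide C (Cod C f))"

definition isomorphic :: "('o, 'a, 'z) cat_scheme \<Rightarrow> 'o \<Rightarrow> 'o \<Rightarrow> bool" where
  "isomorphic C x y \<longleftrightarrow> (\<exists>f \<in> hom C x y. iso C f)"

definition full_subcat :: "('o, 'a) cat \<Rightarrow> ('o \<Rightarrow> bool) \<Rightarrow> ('o, 'a) cat" where
  "full_subcat C P =
     C\<lparr>Obj := {x \<in> Obj C. P x}, Arr := {f \<in> Arr C. P (Dom C f) \<and> P (Cod C f)}\<rparr>"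

record ('o, 'a, 'p, 'b) funct =
  onObj :: "'o \<Rightarrow> 'p"
  onArr :: "'a \<Rightarrow> 'b"

definition funct_id :: "('o, 'a, 'o, 'a) funct" where
  "funct_id = \<lparr>onObj = \<lambda>x. x, onArr = \<lambda>f. f\<rparr>"

definition funct_comp ::
    "('p, 'b, 'q, 'c) funct \<Rightarrow> ('o, 'a, 'p, 'b) funct \<Rightarrow> ('o, 'a, 'q, 'c) funct"
    (infixr "\<circ>\<^sub>F" 70) where
  "G \<circ>\<^sub>F F = \<lparr>onObj = \<lambda>x. onObj G (onObj F x), onArr = \<lambda>f. onArr G (onArr F f)\<rparr>"

locale is_funct = A: category A + B: category B
  for A :: "('o, 'a, 'y) cat_scheme" and B :: "('p, 'b, 'z) cat_scheme" +
  fixes F :: "('o, 'a, 'p, 'b) funct"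
  assumes funct_obj: "x \<in> Obj A \<Longrightarrow> onObj F x \<in> Obj B"
    and funct_hom: "f \<in> hom A x y \<Longrightarrow> onArr F f \<in> hom B (onObj F x) (onObj F y)"
    and funct_ide: "x \<in> Obj A \<Longrightarrow> onArr F (Ide A x) = Ide B (onObj F x)"
    and funct_comp:
      "\<lbrakk>f \<in> hom A x y; g \<in> hom A y z\<rbrakk> \<Longrightarrow> onArr F (g \<cdot>\<^bsub>A\<^esub> f) = onArr F g \<cdot>\<^bsub>B\<^esub> onArr F f"

locale nat_iso = F: is_funct A B F + G: is_funct A B G
  for A :: "('o, 'a, 'y) cat_scheme" and B :: "('p, 'b, 'z) cat_scheme" and F and G +
  fixes \<alpha> :: "'o \<Rightarrow> 'b"
  assumes component: "x \<in> Obj A \<Longrightarrow> \<alpha> x \<in> hom B (onObj F x) (onObj G x)"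
    and component_iso: "x \<in> Obj A \<Longrightarrow> iso B (\<alpha> x)"
    and naturality: "f \<in> hom A x y \<Longrightarrow> \<alpha> y \<cdot>\<^bsub>B\<^esub> onArr F f = onArr G f \<cdot>\<^bsub>B\<^esub> \<alpha> x"


section \<open>Pseudo-functors to Cat and pseudo-natural transformations\<close>

text \<open>
  For \<open>f : X \<rightarrow> Y\<close> and \<open>g : Y \<rightarrow> Z\<close>, \<open>psComp F g f\<close> is the family of components of the
  comparison \<open>F g \<circ> F f \<Rightarrow> F (g \<cdot> f)\<close>, and \<open>psUnit F X\<close> that of \<open>id \<Rightarrow> F (Ide X)\<close>.
\<close>

record ('o, 'a, 'p, 'b) psfunct =
  psCat  :: "'o \<Rightarrow> ('p, 'b) cat"
  psFun  :: "'a \<Rightarrow> ('p, 'b, 'p, 'b) funct"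
  psComp :: "'a \<Rightarrow> 'a \<Rightarrow> 'p \<Rightarrow> 'b"
  psUnit :: "'o \<Rightarrow> 'p \<Rightarrow> 'b"

locale pseudofunctor = category C
  for C :: "('o, 'a, 'z) cat_scheme" (structure) +
  fixes F :: "('o, 'a, 'p, 'b) psfunct"
  assumes ps_cat: "X \<in> Obj C \<Longrightarrow> category (psCat F X)"
    and ps_funct: "f \<in> hom C X Y \<Longrightarrow> is_funct (psCat F X) (psCat F Y) (psFun F f)"
    and ps_comp: "\<lbrakk>f \<in> hom C X Y; g \<in> hom C Y Z\<rbrakk> \<Longrightarrow>
      nat_iso (psCat F X) (psCat F Z) (psFun F g \<circ>\<^sub>F psFun F f) (psFun F (g \<cdot> f)) (psComp F g f)"
    and ps_unit: "X \<in> Obj C \<Longrightarrow>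
      nat_iso (psCat F X) (psCat F X) funct_id (psFun F (Ide C X)) (psUnit F X)"
    and ps_assoc:
      "\<lbrakk>f \<in> hom C X Y; g \<in> hom C Y Z; h \<in> hom C Z W; x \<in> Obj (psCat F X)\<rbrakk> \<Longrightarrow>
        psComp F h (g \<cdot> f) x \<cdot>\<^bsub>psCat F W\<^esub> onArr (psFun F h) (psComp F g f x) =
        psComp F (h \<cdot> g) f x \<cdot>\<^bsub>psCat F W\<^esub> psComp F h g (onObj (psFun F f) x)"
    and ps_unit_right:
      "\<lbrakk>f \<in> hom C X Y; x \<in> Obj (psCat F X)\<rbrakk> \<Longrightarrow>
        psComp F f (Ide C X) x \<cdot>\<^bsub>psCat F Y\<^esub> onArr (psFun F f) (psUnit F X x) =
        Ide (psCat F Y) (onObj (psFun F f) x)"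
    and ps_unit_left:
      "\<lbrakk>f \<in> hom C X Y; x \<in> Obj (psCat F X)\<rbrakk> \<Longrightarrow>
        psComp F (Ide C Y) f x \<cdot>\<^bsub>psCat F Y\<^esub> psUnit F Y (onObj (psFun F f) x) =
        Ide (psCat F Y) (onObj (psFun F f) x)"

text \<open>
  An ordinary functor to Cat, given by its action on objects and on arrows, with identities as
  comparisons.
\<close>

definition strict_psfunct ::
    "('o, 'a, 'z) cat_scheme \<Rightarrow> ('o \<Rightarrow> ('p, 'b) cat) \<Rightarrow> ('a \<Rightarrow> ('p, 'b, 'p, 'b) funct) \<Rightarrow>
     ('o, 'a, 'p, 'b) psfunct" where
  "strict_psfunct C K H =
     \<lparr>psCat = K, psFun = H,
      psComp = \<lambda>g f x. Ide (K (Cod C g)) (onObj (H (g \<cdot>\<^bsub>C\<^esub> f)) x),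
      psUnit = \<lambda>X x. Ide (K X) x\<rparr>"

text \<open>
  The 2-cell of a pseudo-natural transformation \<open>\<eta> : F \<rightarrow> G\<close> at \<open>f : X \<rightarrow> Y\<close> is directed
  \<open>\<tau> f : G f \<circ> \<eta> X \<Rightarrow> \<eta> Y \<circ> F f\<close>.
\<close>

locale pseudonatural = F: pseudofunctor C F + G: pseudofunctor C G
  for C :: "('o, 'a, 'z) cat_scheme" (structure)
    and F :: "('o, 'a, 'p, 'b) psfunct" and G :: "('o, 'a, 'q, 'c) psfunct" +
  fixes \<eta> :: "'o \<Rightarrow> ('p, 'b, 'q, 'c) funct" and \<tau> :: "'a \<Rightarrow> 'p \<Rightarrow> 'c"
  assumes pn_funct: "X \<in> Obj C \<Longrightarrow> is_funct (psCat F X) (psCat G X) (\<eta> X)"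
    and pn_cell: "f \<in> hom C X Y \<Longrightarrow>
      nat_iso (psCat F X) (psCat G Y) (psFun G f \<circ>\<^sub>F \<eta> X) (\<eta> Y \<circ>\<^sub>F psFun F f) (\<tau> f)"
    and pn_comp:
      "\<lbrakk>f \<in> hom C X Y; g \<in> hom C Y Z; x \<in> Obj (psCat F X)\<rbrakk> \<Longrightarrow>
        \<tau> (g \<cdot> f) x \<cdot>\<^bsub>psCat G Z\<^esub> psComp G g f (onObj (\<eta> X) x) =
        onArr (\<eta> Z) (psComp F g f x) \<cdot>\<^bsub>psCat G Z\<^esub>
          (\<tau> g (onObj (psFun F f) x) \<cdot>\<^bsub>psCat G Z\<^esub> onArr (psFun G g) (\<tau> f x))"
    and pn_unit:
      "\<lbrakk>X \<in> Obj C; x \<in> Obj (psCat F X)\<rbrakk> \<Longrightarrow>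
        \<tau> (Ide C X) x \<cdot>\<^bsub>psCat G X\<^esub> psUnit G X (onObj (\<eta> X) x) =
        onArr (\<eta> X) (psUnit F X x)"


section \<open>Finite limits\<close>

definition is_cone ::
    "('i, 'u, 'y) cat_scheme \<Rightarrow> ('o, 'a, 'z) cat_scheme \<Rightarrow> ('i, 'u, 'o, 'a) funct \<Rightarrow>
     'o \<Rightarrow> ('i \<Rightarrow> 'a) \<Rightarrow> bool" where
  "is_cone J C D c p \<longleftrightarrow> c \<in> Obj C \<and> (\<forall>j \<in> Obj J. p j \<in> hom C c (onObj D j)) \<and>
     (\<forall>u \<in> Arr J. onArr D u \<cdot>\<^bsub>C\<^esub> p (Dom J u) = p (Cod J u))"

definition is_limit ::
    "('i, 'u, 'y) cat_scheme \<Rightarrow> ('o, 'a, 'z) cat_scheme \<Rightarrow> ('i, 'u, 'o, 'a) funct \<Rightarrow>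
     'o \<Rightarrow> ('i \<Rightarrow> 'a) \<Rightarrow> bool" where
  "is_limit J C D c p \<longleftrightarrow> is_cone J C D c p \<and>
     (\<forall>d q. is_cone J C D d q \<longrightarrow>
        (\<exists>!h. h \<in> hom C d c \<and> (\<forall>j \<in> Obj J. p j \<cdot>\<^bsub>C\<^esub> h = q j)))"

text \<open>Every finite category is isomorphic to one whose objects and arrows are natural numbers.\<close>

definition finitely_complete :: "('o, 'a, 'z) cat_scheme \<Rightarrow> bool" where
  "finitely_complete C \<longleftrightarrow>
     (\<forall>(J :: (nat, nat) cat) D. finite (Obj J) \<and> finite (Arr J) \<and> is_funct J C D \<longrightarrow>
        (\<exists>c p. is_limit J C D c p))"


section \<open>Factorization systems, neighborhoods and adherence\<close>

definition orth :: "('o, 'a, 'z) cat_scheme \<Rightarrow> 'a \<Rightarrow> 'a \<Rightarrow> bool" where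
  "orth C e m \<longleftrightarrow> e \<in> Arr C \<and> m \<in> Arr C \<and>
     (\<forall>f \<in> hom C (Dom C e) (Dom C m). \<forall>g \<in> hom C (Cod C e) (Cod C m).
        g \<cdot>\<^bsub>C\<^esub> e = m \<cdot>\<^bsub>C\<^esub> f \<longrightarrow>
        (\<exists>!u. u \<in> hom C (Cod C e) (Dom C m) \<and> u \<cdot>\<^bsub>C\<^esub> e = f \<and> m \<cdot>\<^bsub>C\<^esub> u = g))"

text \<open>
  The fixed factorization of an arrow \<open>p\<close> is \<open>p = discPart p \<cdot> finPart p\<close>; thus \<open>discPart p\<close>
  is the reflection of \<open>p\<close> and \<open>finPart p\<close> is the reflection map.
\<close>

record ('o, 'a) fact_cat = "('o, 'a) cat" +
  Final    :: "'a set"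
  Discrete :: "'a set"
  finPart  :: "'a \<Rightarrow> 'a"
  discPart :: "'a \<Rightarrow> 'a"
  One      :: "'o"

locale fact_system = category C
  for C :: "('o, 'a, 'z) fact_cat_scheme" (structure) +
  assumes finite_limits: "finitely_complete C"
    and one_obj: "One C \<in> Obj C"
    and one_terminal: "X \<in> Obj C \<Longrightarrow> \<exists>!u. u \<in> hom C X (One C)"
    and final_eq: "Final C = {e \<in> Arr C. \<forall>m \<in> Discrete C. orth C e m}"
    and discrete_eq: "Discrete C = {m \<in> Arr C. \<forall>e \<in> Final C. orth C e m}"
    and finPart: "p \<in> Arr C \<Longrightarrow> finPart C p \<in> Final C"
    and discPart: "p \<in> Arr C \<Longrightarrow> discPart C p \<in> Discrete C"
    and factor: "p \<in> Arr C \<Longrightarrow>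
      Dom C (finPart C p) = Dom C p \<and> Cod C (finPart C p) = Dom C (discPart C p) \<and>
      Cod C (discPart C p) = Cod C p \<and> discPart C p \<cdot> finPart C p = p"

text \<open>An arrow of the slice from \<open>p\<close> to \<open>q\<close> given by \<open>h\<close> is encoded as the triple \<open>(p, h, q)\<close>.\<close>

definition slice :: "('o, 'a, 'z) cat_scheme \<Rightarrow> 'o \<Rightarrow> ('a, 'a \<times> 'a \<times> 'a) cat" where
  "slice C X =
     \<lparr>Obj = {p \<in> Arr C. Cod C p = X},
      Arr = {(p, h, q). p \<in> Arr C \<and> Cod C p = X \<and> q \<in> Arr C \<and> Cod C q = X \<and>
                        h \<in> hom C (Dom C p) (Dom C q) \<and> q \<cdot>\<^bsub>C\<^esub> h = p},
      Dom = (\<lambda>(p, h, q). p),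
      Cod = (\<lambda>(p, h, q). q),
      Ide = (\<lambda>p. (p, Ide C (Dom C p), p)),
      Comp = (\<lambda>(q', k, r) (p, h, q). (p, k \<cdot>\<^bsub>C\<^esub> h, r))\<rparr>"

definition disc_slice :: "('o, 'a, 'z) fact_cat_scheme \<Rightarrow> 'o \<Rightarrow> ('a, 'a \<times> 'a \<times> 'a) cat" where
  "disc_slice C X = full_subcat (slice C X) (\<lambda>m. m \<in> Discrete C)"

text \<open>For \<open>n\<close> discrete, the factorization of \<open>h : p \<rightarrow> n\<close> through the reflection of \<open>p\<close>.\<close>

definition refl_ext :: "('o, 'a, 'z) fact_cat_scheme \<Rightarrow> 'a \<Rightarrow> 'a \<Rightarrow> 'a \<Rightarrow> 'a" where
  "refl_ext C p n h =
     (THE k. k \<in> hom C (Dom C (discPart C p)) (Dom C n) \<and>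
             n \<cdot>\<^bsub>C\<^esub> k = discPart C p \<and> k \<cdot>\<^bsub>C\<^esub> finPart C p = h)"

abbreviation nbhd :: "('o, 'a, 'z) fact_cat_scheme \<Rightarrow> 'a \<Rightarrow> 'a" where
  "nbhd C x \<equiv> discPart C x"

text \<open>
  The full subcategory on the neighborhoods is taken closed under isomorphism in the category of
  discrete spaces over \<open>X\<close>: the direct image of a neighborhood of \<open>x\<close> is in general only
  isomorphic to the chosen neighborhood of \<open>f \<cdot> x\<close>.
\<close>

definition adh :: "('o, 'a, 'z) fact_cat_scheme \<Rightarrow> 'o \<Rightarrow> ('a, 'a \<times> 'a \<times> 'a) cat" where
  "adh C X = full_subcat (disc_slice C X)
     (\<lambda>m. \<exists>x \<in> hom C (One C) X. isomorphic (disc_slice C X) m (nbhd C x))"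

definition dir_image ::
    "('o, 'a, 'z) fact_cat_scheme \<Rightarrow> 'a \<Rightarrow> ('a, 'a \<times> 'a \<times> 'a, 'a, 'a \<times> 'a \<times> 'a) funct" where
  "dir_image C f =
     \<lparr>onObj = (\<lambda>m. discPart C (f \<cdot>\<^bsub>C\<^esub> m)),
      onArr = (\<lambda>(m, h, n).
        (discPart C (f \<cdot>\<^bsub>C\<^esub> m),
         refl_ext C (f \<cdot>\<^bsub>C\<^esub> m) (discPart C (f \<cdot>\<^bsub>C\<^esub> n)) (finPart C (f \<cdot>\<^bsub>C\<^esub> n) \<cdot>\<^bsub>C\<^esub> h),
         discPart C (f \<cdot>\<^bsub>C\<^esub> n)))\<rparr>"

text \<open>
  The comparisons are the canonical ones between composite reflections: those compatible with the
  reflection maps.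
\<close>

definition adherence ::
    "('o, 'a, 'z) fact_cat_scheme \<Rightarrow> ('o, 'a, 'a, 'a \<times> 'a \<times> 'a) psfunct" where
  "adherence C =
     \<lparr>psCat = adh C,
      psFun = dir_image C,
      psComp = (\<lambda>g f m.
        let n = discPart C (f \<cdot>\<^bsub>C\<^esub> m);
            p = discPart C (g \<cdot>\<^bsub>C\<^esub> n);
            q = discPart C (g \<cdot>\<^bsub>C\<^esub> (f \<cdot>\<^bsub>C\<^esub> m))
        in (p,
            THE k. k \<in> hom C (Dom C p) (Dom C q) \<and> q \<cdot>\<^bsub>C\<^esub> k = p \<and>
              k \<cdot>\<^bsub>C\<^esub> (finPart C (g \<cdot>\<^bsub>C\<^esub> n) \<cdot>\<^bsub>C\<^esub> finPart C (f \<cdot>\<^bsub>C\<^esub> m)) =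
              finPart C (g \<cdot>\<^bsub>C\<^esub> (f \<cdot>\<^bsub>C\<^esub> m)),
            q)),
      psUnit = (\<lambda>X m.
        (m, finPart C (Ide C X \<cdot>\<^bsub>C\<^esub> m), discPart C (Ide C X \<cdot>\<^bsub>C\<^esub> m)))\<rparr>"


section \<open>Arrow objects and the category of points and arrows\<close>

text \<open>
  \<open>Three\<close> is the pushout of two copies of \<open>Two\<close>, with its distinguished arrows
  \<open>threeA : a \<Rightarrow> b\<close>, \<open>threeB : b \<Rightarrow> c\<close>, \<open>threeC : a \<Rightarrow> c\<close>; \<open>Four\<close> glues three consecutive copies
  \<open>fourA\<close>, \<open>fourB\<close>, \<open>fourC\<close> of \<open>Two\<close>.
\<close>

record ('o, 'a) arrow_cat = "('o, 'a) fact_cat" +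
  Two    :: "'o"
  src    :: "'a"
  tgt    :: "'a"
  Three  :: "'o"
  threeA :: "'a"
  threeB :: "'a"
  threeC :: "'a"
  Four   :: "'o"
  fourA  :: "'a"
  fourB  :: "'a"
  fourC  :: "'a"

definition id_arrow :: "('o, 'a, 'z) arrow_cat_scheme \<Rightarrow> 'a \<Rightarrow> 'a" where
  "id_arrow C x = x \<cdot>\<^bsub>C\<^esub> (THE u. u \<in> hom C (Two C) (One C))"

text \<open>The composite of \<open>l : x \<Rightarrow> y\<close> followed by \<open>l' : y \<Rightarrow> z\<close>.\<close>

definition arrow_comp :: "('o, 'a, 'z) arrow_cat_scheme \<Rightarrow> 'a \<Rightarrow> 'a \<Rightarrow> 'a" where
  "arrow_comp C l l' =
     (THE w. w \<in> hom C (Three C) (Cod C l) \<and>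
             w \<cdot>\<^bsub>C\<^esub> threeA C = l \<and> w \<cdot>\<^bsub>C\<^esub> threeB C = l') \<cdot>\<^bsub>C\<^esub> threeC C"

text \<open>
  The last three axioms express that composition of arrows is unital and associative, in the
  generic instances: the generic arrow \<open>Ide C (Two C)\<close> of \<open>Two\<close>, and the generic consecutive
  triple of \<open>Four\<close>. The laws in an arbitrary space are the images of these under the maps out of
  \<open>Two\<close> and \<open>Four\<close>.
\<close>

locale lawvere_arrow_cat = fact_system C
  for C :: "('o, 'a, 'z) arrow_cat_scheme" (structure) +
  assumes two_obj: "Two C \<in> Obj C"
    and src_point: "src C \<in> hom C (One C) (Two C)"
    and tgt_point: "tgt C \<in> hom C (One C) (Two C)"
    and tgt_generates: "Discrete C = {m \<in> Arr C. orth C (tgt C) m}"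
    and three_obj: "Three C \<in> Obj C"
    and threeA_arrow: "threeA C \<in> hom C (Two C) (Three C)"
    and threeB_arrow: "threeB C \<in> hom C (Two C) (Three C)"
    and threeC_arrow: "threeC C \<in> hom C (Two C) (Three C)"
    and three_glue: "threeA C \<cdot> tgt C = threeB C \<cdot> src C"
    and three_pushout:
      "\<lbrakk>l \<in> hom C (Two C) X; l' \<in> hom C (Two C) X; l \<cdot> tgt C = l' \<cdot> src C\<rbrakk> \<Longrightarrow>
        \<exists>!w. w \<in> hom C (Three C) X \<and> w \<cdot> threeA C = l \<and> w \<cdot> threeB C = l'"
    and threeC_src: "threeC C \<cdot> src C = threeA C \<cdot> src C"
    and threeC_tgt: "threeC C \<cdot> tgt C = threeB C \<cdot> tgt C"
    and three_distinct: "distinct [threeA C, threeB C, threeC C]"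
    and three_arrows:
      "{l \<in> hom C (Two C) (Three C). \<not> (\<exists>x \<in> hom C (One C) (Three C). l = id_arrow C x)} =
        {threeA C, threeB C, threeC C}"
    and four_obj: "Four C \<in> Obj C"
    and fourA_arrow: "fourA C \<in> hom C (Two C) (Four C)"
    and fourB_arrow: "fourB C \<in> hom C (Two C) (Four C)"
    and fourC_arrow: "fourC C \<in> hom C (Two C) (Four C)"
    and four_glue: "fourA C \<cdot> tgt C = fourB C \<cdot> src C" "fourB C \<cdot> tgt C = fourC C \<cdot> src C"
    and four_pushout:
      "\<lbrakk>l \<in> hom C (Two C) X; l' \<in> hom C (Two C) X; l'' \<in> hom C (Two C) X;
        l \<cdot> tgt C = l' \<cdot> src C; l' \<cdot> tgt C = l'' \<cdot> src C\<rbrakk> \<Longrightarrow>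
        \<exists>!w. w \<in> hom C (Four C) X \<and> w \<cdot> fourA C = l \<and> w \<cdot> fourB C = l' \<and> w \<cdot> fourC C = l''"
    and unit_src: "arrow_comp C (id_arrow C (src C)) (Ide C (Two C)) = Ide C (Two C)"
    and unit_tgt: "arrow_comp C (Ide C (Two C)) (id_arrow C (tgt C)) = Ide C (Two C)"
    and four_assoc:
      "arrow_comp C (arrow_comp C (fourA C) (fourB C)) (fourC C) =
       arrow_comp C (fourA C) (arrow_comp C (fourB C) (fourC C))"

definition star_cat :: "('o, 'a, 'z) arrow_cat_scheme \<Rightarrow> 'o \<Rightarrow> ('a, 'a) cat" where
  "star_cat C X =
     \<lparr>Obj = hom C (One C) X,
      Arr = hom C (Two C) X,
      Dom = (\<lambda>l. l \<cdot>\<^bsub>C\<^esub> src C),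
      Cod = (\<lambda>l. l \<cdot>\<^bsub>C\<^esub> tgt C),
      Ide = id_arrow C,
      Comp = (\<lambda>l' l. arrow_comp C l l')\<rparr>"

definition star_funct :: "('o, 'a, 'z) arrow_cat_scheme \<Rightarrow> 'a \<Rightarrow> ('a, 'a, 'a, 'a) funct" where
  "star_funct C f = \<lparr>onObj = (\<lambda>x. f \<cdot>\<^bsub>C\<^esub> x), onArr = (\<lambda>l. f \<cdot>\<^bsub>C\<^esub> l)\<rparr>"

definition star :: "('o, 'a, 'z) arrow_cat_scheme \<Rightarrow> ('o, 'a, 'a, 'a) psfunct" where
  "star C = strict_psfunct C (star_cat C) (star_funct C)"

definition lifting :: "('o, 'a, 'z) arrow_cat_scheme \<Rightarrow> 'a \<Rightarrow> 'a \<Rightarrow> 'a \<Rightarrow> 'a" where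
  "lifting C m l a =
     (THE u. u \<in> hom C (Two C) (Dom C m) \<and> m \<cdot>\<^bsub>C\<^esub> u = l \<and> u \<cdot>\<^bsub>C\<^esub> tgt C = a)"

definition star_to_adh ::
    "('o, 'a, 'z) arrow_cat_scheme \<Rightarrow> 'o \<Rightarrow> ('a, 'a, 'a, 'a \<times> 'a \<times> 'a) funct" where
  "star_to_adh C X =
     \<lparr>onObj = nbhd C,
      onArr = (\<lambda>l.
        let x = l \<cdot>\<^bsub>C\<^esub> src C;
            y = l \<cdot>\<^bsub>C\<^esub> tgt C;
            u = lifting C (nbhd C y) l (finPart C y)
        in (nbhd C x, refl_ext C x (nbhd C y) (u \<cdot>\<^bsub>C\<^esub> src C), nbhd C y))\<rparr>"

end

theory Submission
  imports Defs
begin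

text \<open>
  The principle behind all verifications is that a map between discrete spaces over \<open>X\<close> is
  determined by its restriction along any final map into its source (\<open>disc_slice_eqI\<close>), and that
  every map over \<open>X\<close> from the source of a final map to a discrete space extends uniquely along it
  (\<open>final_ext\<close>). Thus every arrow of the adherence category is known by one displacement, and an
  equation between composites becomes an equation between maps of the ambient category, which is
  computed by moving reflection maps past extensions.

  All discrete spaces over \<open>X\<close> are treated at once: direct images make the assignment of the
  category of discrete spaces over \<open>X\<close> to \<open>X\<close> a pseudo-functor (\<open>pseudofunctor_direct_images\<close>).
  Its comparisons are extensions along composites of reflection maps, which are final. The adherence
  is the full sub-pseudo-functor on the neighborhoods, and a pseudo-natural transformation that lands
  in a full sub-pseudo-functor restricts to it (\<open>pseudonatural_restrict\<close>).

  The neighborhood of a point \<open>x : 1 \<rightarrow> X\<close> is the direct image along \<open>x\<close> of the identity of \<open>1\<close>.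
  Hence the comparison \<open>\<exists>\<^sub>f \<nu>(x) \<cong> \<nu>(f x)\<close> is a comparison of the direct image pseudo-functor for
  the pair \<open>x, f\<close>, and the two coherence laws of the transformation are instances of the
  associativity and unit laws of that pseudo-functor.

  What remains concerns arrows. Liftings of arrows to discrete spaces are unique, because the target
  point of \<open>2\<close> is orthogonal to all discrete maps. Any arrow in the total space of \<open>\<nu>(y)\<close> that lies
  over \<open>l\<close> and ends at the final point therefore computes the displacement of \<open>l\<close>
  (\<open>displacement\<close>). Constant arrows, composites in the total space, and images under
  \<open>\<nu>(y) \<rightarrow> \<nu>(f y)\<close> supply such arrows, which gives functoriality (\<open>star_to_adh_functor\<close>) and
  naturality (\<open>nbhd_comparison_natural\<close>).
\<close>


section \<open>Functors and strict pseudo-functors\<close>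

lemma is_funct_id: "category A \<Longrightarrow> is_funct A A funct_id"
  by (simp add: is_funct_def is_funct_axioms_def funct_id_def)

lemma is_funct_comp:
  assumes "is_funct A B F" "is_funct B D G"
  shows "is_funct A D (G \<circ>\<^sub>F F)"
proof -
  interpret F: is_funct A B F by fact
  interpret G: is_funct B D G by fact
  show ?thesis
    unfolding is_funct_def is_funct_axioms_def funct_comp_def funct.simps
    using F.A.category_axioms G.B.category_axioms
    by (auto simp: F.funct_obj G.funct_obj F.funct_ide G.funct_ide
        intro: F.funct_hom G.funct_hom)
      (metis F.funct_hom F.funct_comp G.funct_comp)
qed

lemma iso_ide:
  assumes "category A" "x \<in> Obj A"
  shows "iso A (Ide A x)"
  using category.ide_hom [OF assms] category.comp_ide [OF assms(1) category.ide_hom [OF assms]]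
  by (auto simp: iso_def hom_def)

lemma isomorphic_iff:
  "isomorphic A x y \<longleftrightarrow>
    (\<exists>u \<in> hom A x y. \<exists>v \<in> hom A y x. v \<cdot>\<^bsub>A\<^esub> u = Ide A x \<and> u \<cdot>\<^bsub>A\<^esub> v = Ide A y)"
  unfolding isomorphic_def iso_def by (auto simp: hom_def)

lemma isomorphic_trans:
  assumes "category A" "isomorphic A x y" "isomorphic A y z"
  shows "isomorphic A x z"
proof -
  interpret category A by fact
  obtain u v where u: "u \<in> hom A x y" and v: "v \<in> hom A y x"
    and uv: "v \<cdot>\<^bsub>A\<^esub> u = Ide A x" "u \<cdot>\<^bsub>A\<^esub> v = Ide A y"
    using assms(2) by (auto simp: isomorphic_iff)
  obtain u' v' where u': "u' \<in> hom A y z" and v': "v' \<in> hom A z y"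
    and uv': "v' \<cdot>\<^bsub>A\<^esub> u' = Ide A y" "u' \<cdot>\<^bsub>A\<^esub> v' = Ide A z"
    using assms(3) by (auto simp: isomorphic_iff)
  have "(v \<cdot>\<^bsub>A\<^esub> v') \<cdot>\<^bsub>A\<^esub> u' \<cdot>\<^bsub>A\<^esub> u = Ide A x"
    using comp_assoc [OF comp_hom [OF u u'] v' v] comp_assoc [OF u u' v'] uv uv' ide_comp [OF u]
    by simp
  moreover have "(u' \<cdot>\<^bsub>A\<^esub> u) \<cdot>\<^bsub>A\<^esub> v \<cdot>\<^bsub>A\<^esub> v' = Ide A z"
    using comp_assoc [OF comp_hom [OF v' v] u u'] comp_assoc [OF v' v u] uv uv' ide_comp [OF v']
    by simp
  ultimately show ?thesis
    unfolding isomorphic_iff using comp_hom [OF u u'] comp_hom [OF v' v] by blast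
qed

lemma funct_isomorphic:
  assumes "is_funct A B F" "isomorphic A x y"
  shows "isomorphic B (onObj F x) (onObj F y)"
proof -
  interpret is_funct A B F by fact
  obtain u v where u: "u \<in> hom A x y" and v: "v \<in> hom A y x"
    and uv: "v \<cdot>\<^bsub>A\<^esub> u = Ide A x" "u \<cdot>\<^bsub>A\<^esub> v = Ide A y"
    using assms(2) by (auto simp: isomorphic_iff)
  have "x \<in> Obj A" "y \<in> Obj A"
    using u A.dom_obj A.cod_obj by (auto simp: hom_def)
  then show ?thesis
    unfolding isomorphic_iff
    using funct_hom [OF u] funct_hom [OF v] funct_comp [OF u v] funct_comp [OF v u] uv funct_ide
    by (intro bexI [of _ "onArr F u"] bexI [of _ "onArr F v"]) simp_all
qed

lemma nat_iso_ide:
  assumes "is_funct A B F" "is_funct A B G"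
    and "\<And>x. x \<in> Obj A \<Longrightarrow> onObj F x = onObj G x"
    and "\<And>u. u \<in> Arr A \<Longrightarrow> onArr F u = onArr G u"
    and "\<And>x. x \<in> Obj A \<Longrightarrow> \<alpha> x = Ide B (onObj G x)"
  shows "nat_iso A B F G \<alpha>"
proof -
  interpret F: is_funct A B F by fact
  interpret G: is_funct A B G by fact
  have "x \<in> Obj A" "y \<in> Obj A" "u \<in> Arr A" if "u \<in> hom A x y" for u x y
    using that F.A.dom_obj F.A.cod_obj by (auto simp: hom_def)
  then show ?thesis
    by (intro nat_iso.intro nat_iso_axioms.intro assms(1,2))
      (simp_all add: assms(3-5) F.B.ide_hom G.funct_obj iso_ide F.B.category_axioms
        F.B.ide_comp [OF G.funct_hom] F.B.comp_ide [OF G.funct_hom])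
qed

lemma pseudofunctor_strict:
  assumes "category C"
    and K: "\<And>X. X \<in> Obj C \<Longrightarrow> category (K X)"
    and H: "\<And>X Y f. f \<in> hom C X Y \<Longrightarrow> is_funct (K X) (K Y) (H f)"
    and comp_obj: "\<And>X Y Z f g x. f \<in> hom C X Y \<Longrightarrow> g \<in> hom C Y Z \<Longrightarrow> x \<in> Obj (K X) \<Longrightarrow>
      onObj (H (g \<cdot>\<^bsub>C\<^esub> f)) x = onObj (H g) (onObj (H f) x)"
    and comp_arr: "\<And>X Y Z f g u. f \<in> hom C X Y \<Longrightarrow> g \<in> hom C Y Z \<Longrightarrow> u \<in> Arr (K X) \<Longrightarrow>
      onArr (H (g \<cdot>\<^bsub>C\<^esub> f)) u = onArr (H g) (onArr (H f) u)"
    and ide_obj: "\<And>X x. X \<in> Obj C \<Longrightarrow> x \<in> Obj (K X) \<Longrightarrow> onObj (H (Ide C X)) x = x"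
    and ide_arr: "\<And>X u. X \<in> Obj C \<Longrightarrow> u \<in> Arr (K X) \<Longrightarrow> onArr (H (Ide C X)) u = u"
  shows "pseudofunctor C (strict_psfunct C K H)"
proof -
  interpret category C by fact
  have cod: "Cod C f = Y" and obj: "X \<in> Obj C" "Y \<in> Obj C" if "f \<in> hom C X Y" for f X Y
    using that dom_obj cod_obj by (auto simp: hom_def)
  have H_obj: "onObj (H f) x \<in> Obj (K Y)" if "f \<in> hom C X Y" "x \<in> Obj (K X)" for f X Y x
    using is_funct.funct_obj [OF H] that .
  have H_ide: "onArr (H f) (Ide (K X) x) = Ide (K Y) (onObj (H f) x)"
    if "f \<in> hom C X Y" "x \<in> Obj (K X)" for f X Y x
    using is_funct.funct_ide [OF H] that .
  have idem: "Ide (K X) x \<cdot>\<^bsub>K X\<^esub> Ide (K X) x = Ide (K X) x"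
    if "X \<in> Obj C" "x \<in> Obj (K X)" for X x
    using category.comp_ide [OF K category.ide_hom [OF K]] that by blast
  show ?thesis
    unfolding strict_psfunct_def
  proof (intro pseudofunctor.intro category_axioms pseudofunctor_axioms.intro,
      unfold psfunct.simps)
    fix f g X Y Z assume f: "f \<in> hom C X Y" and g: "g \<in> hom C Y Z"
    show "nat_iso (K X) (K Z) (H g \<circ>\<^sub>F H f) (H (g \<cdot>\<^bsub>C\<^esub> f))
        (\<lambda>x. Ide (K (Cod C g)) (onObj (H (g \<cdot>\<^bsub>C\<^esub> f)) x))"
      using comp_obj [OF f g] comp_arr [OF f g] cod [OF g]
      by (intro nat_iso_ide is_funct_comp [OF H [OF f] H [OF g]] H [OF comp_hom [OF f g]])
        (simp_all add: funct_comp_def)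
  next
    fix X assume X: "X \<in> Obj C"
    show "nat_iso (K X) (K X) funct_id (H (Ide C X)) (Ide (K X))"
      using ide_obj [OF X] ide_arr [OF X]
      by (intro nat_iso_ide is_funct_id K H X ide_hom) (simp_all add: funct_id_def)
  next
    fix f g h X Y Z W x
    assume f: "f \<in> hom C X Y" and g: "g \<in> hom C Y Z" and h: "h \<in> hom C Z W" and x: "x \<in> Obj (K X)"
    have "h \<cdot>\<^bsub>C\<^esub> g \<cdot>\<^bsub>C\<^esub> f = (h \<cdot>\<^bsub>C\<^esub> g) \<cdot>\<^bsub>C\<^esub> f"
      using comp_assoc [OF f g h] by simp
    then show "Ide (K (Cod C h)) (onObj (H (h \<cdot>\<^bsub>C\<^esub> g \<cdot>\<^bsub>C\<^esub> f)) x) \<cdot>\<^bsub>K W\<^esub>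
        onArr (H h) (Ide (K (Cod C g)) (onObj (H (g \<cdot>\<^bsub>C\<^esub> f)) x)) =
        Ide (K (Cod C (h \<cdot>\<^bsub>C\<^esub> g))) (onObj (H ((h \<cdot>\<^bsub>C\<^esub> g) \<cdot>\<^bsub>C\<^esub> f)) x) \<cdot>\<^bsub>K W\<^esub>
        Ide (K (Cod C h)) (onObj (H (h \<cdot>\<^bsub>C\<^esub> g)) (onObj (H f) x))"
      using f g h x comp_hom [OF f g] comp_hom [OF g h] obj [OF h]
      by (simp add: cod [OF comp_hom [OF g h]] cod [OF g] cod [OF h] H_ide [OF h] H_obj [OF comp_hom [OF f g]]
          comp_obj [OF f comp_hom [OF g h], symmetric] comp_obj [OF comp_hom [OF f g] h, symmetric])
  next
    fix f X Y x assume f: "f \<in> hom C X Y" and x: "x \<in> Obj (K X)"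
    have "f \<cdot>\<^bsub>C\<^esub> Ide C X = f" "Ide C Y \<cdot>\<^bsub>C\<^esub> f = f"
      using f by (auto intro: comp_ide ide_comp)
    then show "Ide (K (Cod C f)) (onObj (H (f \<cdot>\<^bsub>C\<^esub> Ide C X)) x) \<cdot>\<^bsub>K Y\<^esub> onArr (H f) (Ide (K X) x) =
        Ide (K Y) (onObj (H f) x)"
      and "Ide (K (Cod C (Ide C Y))) (onObj (H (Ide C Y \<cdot>\<^bsub>C\<^esub> f)) x) \<cdot>\<^bsub>K Y\<^esub>
        Ide (K Y) (onObj (H f) x) = Ide (K Y) (onObj (H f) x)"
      using f x obj [OF f] by (simp_all add: cod [OF f] cod [OF ide_hom] H_ide [OF f] idem H_obj [OF f])
  qed (simp_all add: K H)
qed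


section \<open>Full subcategories\<close>

lemma full_subcat_sel [simp]:
  "Obj (full_subcat A P) = {x \<in> Obj A. P x}"
  "Dom (full_subcat A P) = Dom A"
  "Cod (full_subcat A P) = Cod A"
  "Ide (full_subcat A P) = Ide A"
  "Comp (full_subcat A P) = Comp A"
  by (simp_all add: full_subcat_def)

lemma hom_full_subcat:
  "f \<in> hom (full_subcat A P) x y \<longleftrightarrow> f \<in> hom A x y \<and> P x \<and> P y"
  by (auto simp: hom_def full_subcat_def)

lemma full_subcat_True: "full_subcat A (\<lambda>_. True) = A"
  by (simp add: full_subcat_def)

lemma category_full_subcat:
  assumes "category A"
  shows "category (full_subcat A P)"
proof -
  interpret category A by fact
  show ?thesis
  proof
    fix f assume "f \<in> Arr (full_subcat A P)"
    then have "f \<in> Arr A" "P (Dom A f)" "P (Cod A f)"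
      by (auto simp: full_subcat_def)
    then show "Dom (full_subcat A P) f \<in> Obj (full_subcat A P)"
      and "Cod (full_subcat A P) f \<in> Obj (full_subcat A P)"
      by (simp_all add: dom_obj cod_obj)
  qed (auto simp: hom_full_subcat intro: ide_hom comp_hom comp_ide ide_comp comp_assoc)
qed

lemma iso_full_subcat:
  assumes "iso A f" "P (Dom A f)" "P (Cod A f)"
  shows "iso (full_subcat A P) f"
  using assms by (auto simp: iso_def hom_def full_subcat_def)

lemma is_funct_full_subcat:
  assumes "is_funct A B F"
    and "\<And>x. x \<in> Obj A \<Longrightarrow> P x \<Longrightarrow> Q (onObj F x)"
  shows "is_funct (full_subcat A P) (full_subcat B Q) F"
proof -
  interpret is_funct A B F by fact
  have "x \<in> Obj A" "y \<in> Obj A" if "f \<in> hom A x y" for f x y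
    using that A.dom_obj A.cod_obj by (auto simp: hom_def)
  then show ?thesis
    unfolding is_funct_def is_funct_axioms_def
    by (auto simp: category_full_subcat A.category_axioms B.category_axioms hom_full_subcat
        funct_obj funct_hom funct_ide funct_comp assms(2))
qed

text \<open>
  The inverse of a component needs no separate treatment: fullness puts it into the subcategory.
\<close>

lemma nat_iso_full_subcat:
  assumes "nat_iso A B F G \<alpha>"
    and "\<And>x. x \<in> Obj A \<Longrightarrow> P x \<Longrightarrow> Q (onObj F x)"
    and "\<And>x. x \<in> Obj A \<Longrightarrow> P x \<Longrightarrow> Q (onObj G x)"
  shows "nat_iso (full_subcat A P) (full_subcat B Q) F G \<alpha>"
proof -
  interpret nat_iso A B F G \<alpha> by fact
  have iso: "iso (full_subcat B Q) (\<alpha> x)" if "x \<in> Obj A" "P x" for x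
    using component [OF that(1)]
    by (intro iso_full_subcat component_iso that) (simp_all add: hom_def assms(2,3) that)
  show ?thesis
    unfolding nat_iso_def nat_iso_axioms_def
    using is_funct_full_subcat [OF F.is_funct_axioms] is_funct_full_subcat [OF G.is_funct_axioms]
    by (auto simp: hom_full_subcat component naturality iso assms(2,3))
qed

text \<open>
  The comparisons are kept, so the coherence laws are those of the ambient pseudo-functor. This is
  how the adherence arises from all discrete spaces.
\<close>

definition restrict_psfunct ::
    "('o, 'a, 'p, 'b) psfunct \<Rightarrow> ('o \<Rightarrow> 'p \<Rightarrow> bool) \<Rightarrow> ('o, 'a, 'p, 'b) psfunct" where
  "restrict_psfunct F P = F\<lparr>psCat := \<lambda>X. full_subcat (psCat F X) (P X)\<rparr>"

lemma restrict_psfunct_sel [simp]: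
  "psCat (restrict_psfunct F P) = (\<lambda>X. full_subcat (psCat F X) (P X))"
  "psFun (restrict_psfunct F P) = psFun F"
  "psComp (restrict_psfunct F P) = psComp F"
  "psUnit (restrict_psfunct F P) = psUnit F"
  by (simp_all add: restrict_psfunct_def)

lemma pseudofunctor_restrict:
  assumes "pseudofunctor C F"
    and P: "\<And>X Y f x. f \<in> hom C X Y \<Longrightarrow> x \<in> Obj (psCat F X) \<Longrightarrow> P X x \<Longrightarrow>
      P Y (onObj (psFun F f) x)"
  shows "pseudofunctor C (restrict_psfunct F P)"
proof -
  interpret pseudofunctor C F by fact
  have obj: "onObj (psFun F f) x \<in> Obj (psCat F Y)"
    if "f \<in> hom C X Y" "x \<in> Obj (psCat F X)" for f X Y x
    using is_funct.funct_obj [OF ps_funct] that .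
  show ?thesis
  proof (intro pseudofunctor.intro category_axioms pseudofunctor_axioms.intro,
      unfold restrict_psfunct_sel full_subcat_sel)
    fix f X Y assume f: "f \<in> hom C X Y"
    show "is_funct (full_subcat (psCat F X) (P X)) (full_subcat (psCat F Y) (P Y)) (psFun F f)"
      using P [OF f] by (rule is_funct_full_subcat [OF ps_funct [OF f]])
  next
    fix f g X Y Z assume f: "f \<in> hom C X Y" and g: "g \<in> hom C Y Z"
    show "nat_iso (full_subcat (psCat F X) (P X)) (full_subcat (psCat F Z) (P Z))
        (psFun F g \<circ>\<^sub>F psFun F f) (psFun F (g \<cdot>\<^bsub>C\<^esub> f)) (psComp F g f)"
      using P [OF comp_hom [OF f g]] P [OF f] P [OF g] obj [OF f]
      by (intro nat_iso_full_subcat [OF ps_comp [OF f g]]) (simp_all add: funct_comp_def)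
  next
    fix X assume X: "X \<in> Obj C"
    show "nat_iso (full_subcat (psCat F X) (P X)) (full_subcat (psCat F X) (P X))
        funct_id (psFun F (Ide C X)) (psUnit F X)"
      using P [OF ide_hom [OF X]]
      by (intro nat_iso_full_subcat [OF ps_unit [OF X]]) (simp_all add: funct_id_def)
  qed (simp_all add: category_full_subcat ps_cat ps_assoc ps_unit_right ps_unit_left)
qed

lemma pseudonatural_restrict:
  assumes "pseudonatural C F G \<eta> \<tau>"
    and P: "\<And>X Y f x. f \<in> hom C X Y \<Longrightarrow> x \<in> Obj (psCat G X) \<Longrightarrow> P X x \<Longrightarrow>
      P Y (onObj (psFun G f) x)"
    and \<eta>: "\<And>X x. X \<in> Obj C \<Longrightarrow> x \<in> Obj (psCat F X) \<Longrightarrow> P X (onObj (\<eta> X) x)"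
  shows "pseudonatural C F (restrict_psfunct G P) \<eta> \<tau>"
proof -
  interpret pseudonatural C F G \<eta> \<tau> by fact
  interpret R: pseudofunctor C "restrict_psfunct G P"
    by (rule pseudofunctor_restrict [OF G.pseudofunctor_axioms]) (rule P)
  have obj: "X \<in> Obj C" "Y \<in> Obj C" if "f \<in> hom C X Y" for f X Y
    using that F.dom_obj F.cod_obj by (auto simp: hom_def)
  show ?thesis
  proof (intro pseudonatural.intro F.pseudofunctor_axioms R.pseudofunctor_axioms
      pseudonatural_axioms.intro, unfold restrict_psfunct_sel full_subcat_sel)
    fix X assume X: "X \<in> Obj C"
    show "is_funct (psCat F X) (full_subcat (psCat G X) (P X)) (\<eta> X)"
      using is_funct_full_subcat [OF pn_funct [OF X], where P = "\<lambda>_. True" and Q = "P X"] \<eta> [OF X]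
      by (simp add: full_subcat_True)
  next
    fix f X Y assume f: "f \<in> hom C X Y"
    have "x \<in> Obj (psCat F X) \<Longrightarrow> onObj (\<eta> X) x \<in> Obj (psCat G X)"
      and "x \<in> Obj (psCat F X) \<Longrightarrow> onObj (psFun F f) x \<in> Obj (psCat F Y)" for x
      using is_funct.funct_obj [OF pn_funct] is_funct.funct_obj [OF F.ps_funct] obj f by metis+
    then show "nat_iso (psCat F X) (full_subcat (psCat G Y) (P Y))
        (psFun G f \<circ>\<^sub>F \<eta> X) (\<eta> Y \<circ>\<^sub>F psFun F f) (\<tau> f)"
      using nat_iso_full_subcat [OF pn_cell [OF f], where P = "\<lambda>_. True" and Q = "P Y"]
        \<eta> P [OF f] obj [OF f]
      by (simp add: full_subcat_True funct_comp_def)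
  qed (simp_all add: pn_comp pn_unit)
qed


section \<open>Calculating in a category\<close>

abbreviation underlying :: "'a \<times> 'a \<times> 'a \<Rightarrow> 'a" where
  "underlying \<phi> \<equiv> fst (snd \<phi>)"

context category
begin

lemmas in_hom = hom_def [of C]

lemma arr_comp [simp]:
  assumes "f \<in> Arr C" "g \<in> Arr C" "Cod C f = Dom C g"
  shows "g \<cdot> f \<in> Arr C" "Dom C (g \<cdot> f) = Dom C f" "Cod C (g \<cdot> f) = Cod C g"
  using comp_hom [of f "Dom C f" "Cod C f" g "Cod C g"] assms by (simp_all add: hom_def)

lemma arr_ide [simp]:
  assumes "x \<in> Obj C"
  shows "Ide C x \<in> Arr C" "Dom C (Ide C x) = x" "Cod C (Ide C x) = x"
  using ide_hom [OF assms] by (simp_all add: hom_def)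

lemma comp_arr_ide [simp]: "f \<in> Arr C \<Longrightarrow> Dom C f = x \<Longrightarrow> f \<cdot> Ide C x = f"
  and comp_ide_arr [simp]: "f \<in> Arr C \<Longrightarrow> Cod C f = x \<Longrightarrow> Ide C x \<cdot> f = f"
  using comp_ide ide_comp by (auto simp: hom_def)

lemma assoc [simp]:
  assumes "f \<in> Arr C" "g \<in> Arr C" "h \<in> Arr C" "Cod C f = Dom C g" "Cod C g = Dom C h"
  shows "(h \<cdot> g) \<cdot> f = h \<cdot> g \<cdot> f"
  using comp_assoc [of f "Dom C f" "Cod C f" g "Cod C g" h "Cod C h"] assms
  by (simp add: hom_def)

lemma obj_dom_cod [simp]: "f \<in> Arr C \<Longrightarrow> Dom C f \<in> Obj C" "f \<in> Arr C \<Longrightarrow> Cod C f \<in> Obj C"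
  by (rule dom_obj cod_obj; assumption)+

lemma hom_obj: "f \<in> hom C x y \<Longrightarrow> x \<in> Obj C" "f \<in> hom C x y \<Longrightarrow> y \<in> Obj C"
  by (auto simp: hom_def)

text \<open>
  Composites are kept associated to the right by the simplifier, so an equation for \<open>g \<cdot> f\<close> has to
  be available also in front of a further factor.
\<close>

lemma comp_rewrite:
  assumes "g \<cdot> f = k" "f \<in> Arr C" "g \<in> Arr C" "Cod C f = Dom C g" "z \<in> Arr C" "Cod C z = Dom C f"
  shows "g \<cdot> f \<cdot> z = k \<cdot> z"
  using assms by (metis assoc)

text \<open>
  An arrow of a slice carries its source and target, so equality of such arrows is reduced to the
  equality of the underlying maps.
\<close>

lemma slice_sel:
  "Obj (slice C X) = {p \<in> Arr C. Cod C p = X}"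
  "Dom (slice C X) \<phi> = fst \<phi>"
  "Cod (slice C X) \<phi> = snd (snd \<phi>)"
  "Ide (slice C X) p = (p, Ide C (Dom C p), p)"
  "\<psi> \<cdot>\<^bsub>slice C X\<^esub> \<phi> = (fst \<phi>, underlying \<psi> \<cdot> underlying \<phi>, snd (snd \<psi>))"
  by (simp_all add: slice_def split_def)

lemma hom_slice:
  "\<phi> \<in> hom (slice C X) p q \<longleftrightarrow> fst \<phi> = p \<and> snd (snd \<phi>) = q \<and>
     p \<in> Arr C \<and> Cod C p = X \<and> q \<in> Arr C \<and> Cod C q = X \<and>
     underlying \<phi> \<in> Arr C \<and> Dom C (underlying \<phi>) = Dom C p \<and>
     Cod C (underlying \<phi>) = Dom C q \<and> q \<cdot> underlying \<phi> = p"
  unfolding hom_def by (cases \<phi>) (auto simp: slice_def hom_def)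

lemma category_slice: "category (slice C X)"
proof (rule category.intro)
  fix \<phi> p q \<psi> r
  assume "\<phi> \<in> hom (slice C X) p q" "\<psi> \<in> hom (slice C X) q r"
  moreover from this have "r \<cdot> underlying \<psi> \<cdot> underlying \<phi> = p"
    by (simp add: hom_slice comp_rewrite)
  ultimately show "\<psi> \<cdot>\<^bsub>slice C X\<^esub> \<phi> \<in> hom (slice C X) p r"
    by (simp add: hom_slice slice_sel)
next
  fix \<phi> assume "\<phi> \<in> Arr (slice C X)"
  then show "Dom (slice C X) \<phi> \<in> Obj (slice C X)" "Cod (slice C X) \<phi> \<in> Obj (slice C X)"
    by (auto simp: slice_def)
qed (simp_all add: hom_slice slice_sel prod_eq_iff)

end


section \<open>Final and discrete maps\<close>

text \<open>
  The extension of \<open>h\<close> along the final map \<open>e\<close> to a map of discrete spaces from \<open>m\<close> to \<open>n\<close>. The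
  final map is a parameter of its own, since the comparisons of direct images extend along composites
  of reflection maps and not only along the chosen reflection map of an arrow.
\<close>

definition final_ext :: "('o, 'a, 'z) cat_scheme \<Rightarrow> 'a \<Rightarrow> 'a \<Rightarrow> 'a \<Rightarrow> 'a \<Rightarrow> 'a" where
  "final_ext C e m n h =
     (THE k. k \<in> hom C (Dom C m) (Dom C n) \<and> n \<cdot>\<^bsub>C\<^esub> k = m \<and> k \<cdot>\<^bsub>C\<^esub> e = h)"

context fact_system
begin

lemma final_arr [simp]: "e \<in> Final C \<Longrightarrow> e \<in> Arr C"
  and discrete_arr [simp]: "m \<in> Discrete C \<Longrightarrow> m \<in> Arr C"
  using final_eq discrete_eq by blast+

lemma factor_sel [simp]:
  assumes "p \<in> Arr C"
  shows "finPart C p \<in> Final C" "discPart C p \<in> Discrete C"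
    "finPart C p \<in> Arr C" "discPart C p \<in> Arr C"
    "Dom C (finPart C p) = Dom C p" "Cod C (finPart C p) = Dom C (discPart C p)"
    "Cod C (discPart C p) = Cod C p" "discPart C p \<cdot> finPart C p = p"
  using assms finPart discPart factor by auto

lemma factor_assoc [simp]:
  assumes "p \<in> Arr C" "z \<in> Arr C" "Cod C z = Dom C p"
  shows "discPart C p \<cdot> finPart C p \<cdot> z = p \<cdot> z"
  using assms by (simp add: comp_rewrite [of "discPart C p" "finPart C p"])

lemma orth_final_discrete: "e \<in> Final C \<Longrightarrow> m \<in> Discrete C \<Longrightarrow> orth C e m"
  using final_eq by blast

lemma finalI: "e \<in> Arr C \<Longrightarrow> (\<And>m. m \<in> Discrete C \<Longrightarrow> orth C e m) \<Longrightarrow> e \<in> Final C"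
  using final_eq by blast

lemma discreteI: "m \<in> Arr C \<Longrightarrow> (\<And>e. e \<in> Final C \<Longrightarrow> orth C e m) \<Longrightarrow> m \<in> Discrete C"
  using discrete_eq by blast

text \<open>
  The existence and the uniqueness of diagonals are needed apart: fillers provide extensions and
  liftings, and cancellation proves equations between them.
\<close>

lemma orth_fill:
  assumes "orth C e m" "f \<in> hom C (Dom C e) (Dom C m)" "g \<in> hom C (Cod C e) (Cod C m)"
    and "g \<cdot> e = m \<cdot> f"
  shows "\<exists>!u. u \<in> hom C (Cod C e) (Dom C m) \<and> u \<cdot> e = f \<and> m \<cdot> u = g"
  using assms by (auto simp: orth_def)

lemma orth_cancel:
  assumes "orth C e m"
    and u: "u \<in> hom C (Cod C e) (Dom C m)" and v: "v \<in> hom C (Cod C e) (Dom C m)"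
    and "u \<cdot> e = v \<cdot> e" "m \<cdot> u = m \<cdot> v"
  shows "u = v"
proof -
  have "e \<in> Arr C" "m \<in> Arr C" using assms(1) by (auto simp: orth_def)
  then have "\<exists>!w. w \<in> hom C (Cod C e) (Dom C m) \<and> w \<cdot> e = u \<cdot> e \<and> m \<cdot> w = m \<cdot> u"
    using u by (intro orth_fill assms(1)) (auto simp: in_hom)
  then show ?thesis using assms by metis
qed

lemmas final_cancel = orth_cancel [OF orth_final_discrete]

lemma discrete_ide:
  assumes "x \<in> Obj C"
  shows "Ide C x \<in> Discrete C"
proof -
  have "orth C e (Ide C x)" if "e \<in> Arr C" for e
    unfolding orth_def using assms that
  proof (intro conjI ballI impI)
    fix f g
    assume "f \<in> hom C (Dom C e) (Dom C (Ide C x))" "g \<in> hom C (Cod C e) (Cod C (Ide C x))"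
      and "g \<cdot> e = Ide C x \<cdot> f"
    then show "\<exists>!u. u \<in> hom C (Cod C e) (Dom C (Ide C x)) \<and> u \<cdot> e = f \<and> Ide C x \<cdot> u = g"
      using assms by (intro ex1I [of _ g]) (simp add: in_hom, metis ide_comp arr_ide(2))
  qed simp_all
  then show ?thesis
    using assms by (simp add: discreteI)
qed

lemma final_ide:
  assumes "x \<in> Obj C"
  shows "Ide C x \<in> Final C"
proof -
  have "orth C (Ide C x) m" if "m \<in> Arr C" for m
    unfolding orth_def using assms that
  proof (intro conjI ballI impI)
    fix f g
    assume "f \<in> hom C (Dom C (Ide C x)) (Dom C m)" "g \<in> hom C (Cod C (Ide C x)) (Cod C m)"
      and "g \<cdot> Ide C x = m \<cdot> f"
    then show "\<exists>!u. u \<in> hom C (Cod C (Ide C x)) (Dom C m) \<and> u \<cdot> Ide C x = f \<and> m \<cdot> u = g"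
      using assms by (intro ex1I [of _ f]) (simp add: in_hom, metis comp_ide arr_ide(3))
  qed simp_all
  then show ?thesis
    using assms by (simp add: finalI)
qed

text \<open>
  A square on \<open>d \<cdot> e\<close> is filled in two steps, first across \<open>e\<close> and then across \<open>d\<close>. This makes a
  composite of reflection maps final, so that iterated direct images are again reflections.
\<close>

lemma final_comp:
  assumes e: "e \<in> Final C" and d: "d \<in> Final C" and seq: "Cod C e = Dom C d"
  shows "d \<cdot> e \<in> Final C"
proof -
  have "orth C (d \<cdot> e) m" if m: "m \<in> Discrete C" for m
  proof -
    have "\<exists>!u. u \<in> hom C (Cod C d) (Dom C m) \<and> u \<cdot> d \<cdot> e = f \<and> m \<cdot> u = g"
      if f: "f \<in> hom C (Dom C e) (Dom C m)" and g: "g \<in> hom C (Cod C d) (Cod C m)"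
        and sq: "g \<cdot> d \<cdot> e = m \<cdot> f" for f g
    proof (rule ex_ex1I)
      have "\<exists>!u. u \<in> hom C (Cod C e) (Dom C m) \<and> u \<cdot> e = f \<and> m \<cdot> u = g \<cdot> d"
        using e d seq m f g sq
        by (intro orth_fill orth_final_discrete) (simp_all add: in_hom)
      then obtain u where u: "u \<in> hom C (Cod C e) (Dom C m)" "u \<cdot> e = f" "m \<cdot> u = g \<cdot> d"
        by blast
      have "\<exists>!v. v \<in> hom C (Cod C d) (Dom C m) \<and> v \<cdot> d = u \<and> m \<cdot> v = g"
        using d seq m g u
        by (intro orth_fill orth_final_discrete) (simp_all add: in_hom)
      then obtain v where v: "v \<in> hom C (Cod C d) (Dom C m)" "v \<cdot> d = u" "m \<cdot> v = g"
        by blast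
      have "v \<cdot> d \<cdot> e = (v \<cdot> d) \<cdot> e"
        using e d seq v(1) by (simp add: in_hom)
      with u v show "\<exists>v. v \<in> hom C (Cod C d) (Dom C m) \<and> v \<cdot> d \<cdot> e = f \<and> m \<cdot> v = g"
        by auto
    next
      fix u v
      assume u: "u \<in> hom C (Cod C d) (Dom C m) \<and> u \<cdot> d \<cdot> e = f \<and> m \<cdot> u = g"
        and v: "v \<in> hom C (Cod C d) (Dom C m) \<and> v \<cdot> d \<cdot> e = f \<and> m \<cdot> v = g"
      have "m \<cdot> u \<cdot> d = m \<cdot> v \<cdot> d"
        using d m u v by (simp add: in_hom comp_rewrite [of m])
      moreover have "u \<cdot> d \<in> hom C (Cod C e) (Dom C m)" "v \<cdot> d \<in> hom C (Cod C e) (Dom C m)"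
        "(u \<cdot> d) \<cdot> e = (v \<cdot> d) \<cdot> e"
        using e d m seq u v by (simp_all add: in_hom)
      ultimately have "u \<cdot> d = v \<cdot> d"
        by - (rule final_cancel [OF e m])
      then show "u = v"
        using u v by (intro final_cancel [OF d m, of u v]) auto
    qed
    then show ?thesis
      using e d m seq by (simp add: orth_def)
  qed
  then show ?thesis
    using e d seq by (simp add: finalI)
qed

lemma final_ext_unique:
  assumes "e \<in> Final C" "m \<in> Arr C" "n \<in> Discrete C" "Cod C e = Dom C m" "Cod C m = Cod C n"
    and "h \<in> hom C (Dom C e) (Dom C n)" "n \<cdot> h = m \<cdot> e"
  shows "\<exists>!k. k \<in> hom C (Dom C m) (Dom C n) \<and> n \<cdot> k = m \<and> k \<cdot> e = h"
  using orth_fill [OF orth_final_discrete, of e n h m] assms by (simp add: in_hom conj_ac)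

lemma final_ext:
  assumes "e \<in> Final C" "m \<in> Arr C" "n \<in> Discrete C" "Cod C e = Dom C m" "Cod C m = Cod C n"
    and "h \<in> hom C (Dom C e) (Dom C n)" "n \<cdot> h = m \<cdot> e"
  shows "final_ext C e m n h \<in> hom C (Dom C m) (Dom C n)"
    and "n \<cdot> final_ext C e m n h = m"
    and "final_ext C e m n h \<cdot> e = h"
  using theI' [OF final_ext_unique [OF assms]] by (simp_all add: final_ext_def)


section \<open>Discrete spaces over a space\<close>

lemma disc_slice_sel [simp]:
  "Obj (disc_slice C X) = {m \<in> Discrete C. Cod C m = X}"
  "Dom (disc_slice C X) \<phi> = fst \<phi>"
  "Cod (disc_slice C X) \<phi> = snd (snd \<phi>)"
  by (auto simp: disc_slice_def slice_sel)

lemma disc_slice_ide_comp [simp]: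
  "Ide (disc_slice C X) m = (m, Ide C (Dom C m), m)"
  "\<psi> \<cdot>\<^bsub>disc_slice C X\<^esub> \<phi> = (fst \<phi>, underlying \<psi> \<cdot> underlying \<phi>, snd (snd \<psi>))"
  by (auto simp: disc_slice_def slice_sel)

lemma hom_disc_slice:
  "\<phi> \<in> hom (disc_slice C X) m n \<longleftrightarrow> fst \<phi> = m \<and> snd (snd \<phi>) = n \<and>
     m \<in> Discrete C \<and> Cod C m = X \<and> n \<in> Discrete C \<and> Cod C n = X \<and>
     underlying \<phi> \<in> Arr C \<and> Dom C (underlying \<phi>) = Dom C m \<and>
     Cod C (underlying \<phi>) = Dom C n \<and> n \<cdot> underlying \<phi> = m"
  by (auto simp: disc_slice_def hom_full_subcat hom_slice)

lemma category_disc_slice: "category (disc_slice C X)"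
  unfolding disc_slice_def by (intro category_full_subcat category_slice)

text \<open>
  Both maps fill the same square between \<open>e\<close> and the discrete map \<open>n\<close>.
\<close>

lemma disc_slice_eqI:
  assumes "\<phi> \<in> hom (disc_slice C X) m n" "\<psi> \<in> hom (disc_slice C X) m n"
    and "e \<in> Final C" "Cod C e = Dom C m" "underlying \<phi> \<cdot> e = underlying \<psi> \<cdot> e"
  shows "\<phi> = \<psi>"
proof -
  have "underlying \<phi> = underlying \<psi>"
    using assms by - (rule final_cancel [of e n], simp_all add: hom_disc_slice in_hom)
  then show ?thesis
    using assms(1,2) by (simp add: hom_disc_slice prod_eq_iff)
qed

text \<open>
  Two factorizations of one map into a final map followed by a discrete one: the extension in the
  opposite direction is inverse, since both round trips restrict to the final map they started from.
\<close>

lemma final_ext_iso: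
  assumes "e \<in> Final C" "d \<in> Final C" "m \<in> Discrete C" "n \<in> Discrete C"
    and "Cod C e = Dom C m" "Cod C d = Dom C n" "Cod C m = X" "Cod C n = X"
    and "Dom C e = Dom C d" "m \<cdot> e = n \<cdot> d"
  shows "(m, final_ext C e m n d, n) \<in> hom (disc_slice C X) m n"
    and "iso (disc_slice C X) (m, final_ext C e m n d, n)"
proof -
  let ?D = "disc_slice C X"
  let ?\<phi> = "(m, final_ext C e m n d, n)" and ?\<psi> = "(n, final_ext C d n m e, m)"
  interpret D: category ?D by (rule category_disc_slice)
  have k: "final_ext C e m n d \<in> hom C (Dom C m) (Dom C n)"
    "n \<cdot> final_ext C e m n d = m" "final_ext C e m n d \<cdot> e = d"
    using assms by (intro final_ext; simp add: in_hom)+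
  have l: "final_ext C d n m e \<in> hom C (Dom C n) (Dom C m)"
    "m \<cdot> final_ext C d n m e = n" "final_ext C d n m e \<cdot> d = e"
    using assms by (intro final_ext; simp add: in_hom)+
  show \<phi>: "?\<phi> \<in> hom ?D m n"
    using k assms by (simp add: hom_disc_slice in_hom)
  have \<psi>: "?\<psi> \<in> hom ?D n m"
    using l assms by (simp add: hom_disc_slice in_hom)
  have "?\<psi> \<cdot>\<^bsub>?D\<^esub> ?\<phi> = Ide ?D m"
    using assms k l
    by (intro disc_slice_eqI [OF D.comp_hom [OF \<phi> \<psi>] D.ide_hom, where e = e])
      (simp_all add: in_hom)
  moreover have "?\<phi> \<cdot>\<^bsub>?D\<^esub> ?\<psi> = Ide ?D n"
    using assms k l
    by (intro disc_slice_eqI [OF D.comp_hom [OF \<psi> \<phi>] D.ide_hom, where e = d])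
      (simp_all add: in_hom)
  moreover have "?\<phi> \<in> Arr ?D"
    using \<phi> by (simp add: hom_def)
  ultimately show "iso ?D ?\<phi>"
    unfolding iso_def using \<psi> by (intro conjI bexI [of _ ?\<psi>]) simp_all
qed


section \<open>Direct images of discrete spaces\<close>

abbreviation img :: "'a \<Rightarrow> 'a \<Rightarrow> 'a" where
  "img f m \<equiv> discPart C (f \<cdot> m)"

abbreviation reflection :: "'a \<Rightarrow> 'a \<Rightarrow> 'a" where
  "reflection f m \<equiv> finPart C (f \<cdot> m)"

lemma dir_image_obj [simp]: "onObj (dir_image C f) m = img f m"
  by (simp add: dir_image_def)

text \<open>
  The second equation is naturality of the reflection map, and it characterizes the direct image of
  an arrow.
\<close>

lemma dir_image_arr:
  assumes f: "f \<in> hom C X Y" and \<phi>: "\<phi> \<in> hom (disc_slice C X) m n"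
  shows "onArr (dir_image C f) \<phi> \<in> hom (disc_slice C Y) (img f m) (img f n)"
    and "underlying (onArr (dir_image C f) \<phi>) \<cdot> reflection f m = reflection f n \<cdot> underlying \<phi>"
proof -
  define k where
    "k = final_ext C (reflection f m) (img f m) (img f n) (reflection f n \<cdot> underlying \<phi>)"
  have "onArr (dir_image C f) \<phi> = (img f m, k, img f n)"
    using \<phi> by (simp add: k_def dir_image_def refl_ext_def final_ext_def split_def hom_disc_slice)
  moreover have "k \<in> hom C (Dom C (img f m)) (Dom C (img f n))"
    and "img f n \<cdot> k = img f m" "k \<cdot> reflection f m = reflection f n \<cdot> underlying \<phi>"
    using f \<phi> unfolding k_def
    by (intro final_ext; simp add: hom_disc_slice in_hom)+
  ultimately show "onArr (dir_image C f) \<phi> \<in> hom (disc_slice C Y) (img f m) (img f n)"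
    and "underlying (onArr (dir_image C f) \<phi>) \<cdot> reflection f m = reflection f n \<cdot> underlying \<phi>"
    using f \<phi> by (simp_all add: hom_disc_slice in_hom)
qed

text \<open>
  The map \<open>g \<cdot> f \<cdot> m\<close> has two factorizations: its own reflection, and the one obtained by reflecting
  first \<open>f \<cdot> m\<close> and then the image of the result.
\<close>

lemma comparison:
  assumes f: "f \<in> hom C X Y" and g: "g \<in> hom C Y Z" and m: "m \<in> Discrete C" "Cod C m = X"
  shows "psComp (adherence C) g f m \<in> hom (disc_slice C Z) (img g (img f m)) (img g (f \<cdot> m))"
    and "iso (disc_slice C Z) (psComp (adherence C) g f m)"
    and "underlying (psComp (adherence C) g f m) \<cdot> reflection g (img f m) \<cdot> reflection f m =
      reflection g (f \<cdot> m)"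
proof -
  define e where "e = reflection g (img f m) \<cdot> reflection f m"
  define k where "k = final_ext C e (img g (img f m)) (img g (f \<cdot> m)) (reflection g (f \<cdot> m))"
  have e: "e \<in> Final C" "Cod C e = Dom C (img g (img f m))" "Dom C e = Dom C m"
    "img g (img f m) \<cdot> e = img g (f \<cdot> m) \<cdot> reflection g (f \<cdot> m)"
    using f g m by (simp_all add: e_def in_hom final_comp)
  have eq: "psComp (adherence C) g f m = (img g (img f m), k, img g (f \<cdot> m))"
    by (simp add: adherence_def Let_def k_def e_def final_ext_def)
  show "psComp (adherence C) g f m \<in> hom (disc_slice C Z) (img g (img f m)) (img g (f \<cdot> m))"
    and "iso (disc_slice C Z) (psComp (adherence C) g f m)"
    using f g m e unfolding eq k_def by (intro final_ext_iso; simp add: in_hom)+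
  have "k \<cdot> e = reflection g (f \<cdot> m)"
    using f g m e unfolding k_def by (intro final_ext; simp add: in_hom)
  then show "underlying (psComp (adherence C) g f m) \<cdot> reflection g (img f m) \<cdot> reflection f m =
      reflection g (f \<cdot> m)"
    by (simp add: eq e_def)
qed

text \<open>
  A discrete space \<open>m\<close> is its own factorization with an identity as final part, so its reflection map
  is the canonical isomorphism between two factorizations of \<open>m\<close>.
\<close>

lemma unit_comparison:
  assumes m: "m \<in> Discrete C" "Cod C m = X"
  shows "psUnit (adherence C) X m \<in> hom (disc_slice C X) m (discPart C m)"
    and "iso (disc_slice C X) (psUnit (adherence C) X m)"
    and "underlying (psUnit (adherence C) X m) = finPart C m"
proof -
  let ?k = "final_ext C (Ide C (Dom C m)) m (discPart C m) (finPart C m)"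
  have "?k \<in> hom C (Dom C m) (Dom C (discPart C m))" "?k \<cdot> Ide C (Dom C m) = finPart C m"
    using m by (intro final_ext; simp add: in_hom final_ide)+
  then have k: "?k = finPart C m"
    by (simp add: in_hom)
  have eq: "psUnit (adherence C) X m = (m, ?k, discPart C m)"
    using m by (simp add: adherence_def k)
  show "psUnit (adherence C) X m \<in> hom (disc_slice C X) m (discPart C m)"
    and "iso (disc_slice C X) (psUnit (adherence C) X m)"
    using m unfolding eq by (intro final_ext_iso; simp add: final_ide)+
  show "underlying (psUnit (adherence C) X m) = finPart C m"
    by (simp add: eq k)
qed

lemma dir_image_functor:
  assumes f: "f \<in> hom C X Y"
  shows "is_funct (disc_slice C X) (disc_slice C Y) (dir_image C f)"
proof -
  interpret A: category "disc_slice C X" by (rule category_disc_slice)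
  interpret B: category "disc_slice C Y" by (rule category_disc_slice)
  note F = dir_image_arr [OF f]
  show ?thesis
  proof (intro is_funct.intro A.category_axioms B.category_axioms is_funct_axioms.intro)
    fix m assume "m \<in> Obj (disc_slice C X)"
    with f show "onObj (dir_image C f) m \<in> Obj (disc_slice C Y)"
      by (simp add: in_hom)
  next
    fix \<phi> m n assume "\<phi> \<in> hom (disc_slice C X) m n"
    then show "onArr (dir_image C f) \<phi> \<in>
        hom (disc_slice C Y) (onObj (dir_image C f) m) (onObj (dir_image C f) n)"
      by (simp add: F)
  next
    fix m assume m: "m \<in> Obj (disc_slice C X)"
    then have i: "Ide (disc_slice C X) m \<in> hom (disc_slice C X) m m"
      by (rule A.ide_hom)
    show "onArr (dir_image C f) (Ide (disc_slice C X) m) =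
        Ide (disc_slice C Y) (onObj (dir_image C f) m)"
    proof (rule disc_slice_eqI [where e = "reflection f m"])
      show "onArr (dir_image C f) (Ide (disc_slice C X) m) \<in>
          hom (disc_slice C Y) (img f m) (img f m)"
        by (rule F(1) [OF i])
      show "Ide (disc_slice C Y) (onObj (dir_image C f) m) \<in>
          hom (disc_slice C Y) (img f m) (img f m)"
        using f m B.ide_hom [of "img f m"] by (simp add: in_hom)
    qed (use f m F(2) [OF i] in \<open>simp_all add: in_hom\<close>)
  next
    fix \<phi> m n \<psi> p
    assume \<phi>: "\<phi> \<in> hom (disc_slice C X) m n" and \<psi>: "\<psi> \<in> hom (disc_slice C X) n p"
    show "onArr (dir_image C f) (\<psi> \<cdot>\<^bsub>disc_slice C X\<^esub> \<phi>) =
        onArr (dir_image C f) \<psi> \<cdot>\<^bsub>disc_slice C Y\<^esub> onArr (dir_image C f) \<phi>"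
    proof (rule disc_slice_eqI [where e = "reflection f m"])
      show "onArr (dir_image C f) (\<psi> \<cdot>\<^bsub>disc_slice C X\<^esub> \<phi>) \<in>
          hom (disc_slice C Y) (img f m) (img f p)"
        by (rule F(1) [OF A.comp_hom [OF \<phi> \<psi>]])
      show "onArr (dir_image C f) \<psi> \<cdot>\<^bsub>disc_slice C Y\<^esub> onArr (dir_image C f) \<phi> \<in>
          hom (disc_slice C Y) (img f m) (img f p)"
        by (rule B.comp_hom [OF F(1) [OF \<phi>] F(1) [OF \<psi>]])
      have "reflection f p \<cdot> underlying \<psi> \<cdot> underlying \<phi> =
          underlying (onArr (dir_image C f) \<psi>) \<cdot> reflection f n \<cdot> underlying \<phi>"
        using f \<phi> \<psi> F(1) [OF \<psi>] by (simp add: comp_rewrite [OF F(2) [OF \<psi>]] hom_disc_slice in_hom)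
      also have "\<dots> = underlying (onArr (dir_image C f) \<psi>) \<cdot>
          underlying (onArr (dir_image C f) \<phi>) \<cdot> reflection f m"
        by (simp only: F(2) [OF \<phi>])
      finally show "underlying (onArr (dir_image C f) (\<psi> \<cdot>\<^bsub>disc_slice C X\<^esub> \<phi>)) \<cdot> reflection f m =
          underlying (onArr (dir_image C f) \<psi> \<cdot>\<^bsub>disc_slice C Y\<^esub> onArr (dir_image C f) \<phi>) \<cdot>
          reflection f m"
        using f \<phi> \<psi> F(1) [OF \<psi>] F(1) [OF \<phi>] F(2) [OF A.comp_hom [OF \<phi> \<psi>]]
        by (simp add: hom_disc_slice in_hom)
    qed (use f \<phi> in \<open>simp_all add: hom_disc_slice in_hom\<close>)
  qed
qed


text \<open>
  Along \<open>reflection g (img f m) \<cdot> reflection f m\<close> both sides restrict to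
  \<open>reflection g (f \<cdot> n) \<cdot> underlying \<phi>\<close>.
\<close>

lemma comparison_natural:
  assumes f: "f \<in> hom C X Y" and g: "g \<in> hom C Y Z" and \<phi>: "\<phi> \<in> hom (disc_slice C X) m n"
  shows "psComp (adherence C) g f n \<cdot>\<^bsub>disc_slice C Z\<^esub> onArr (dir_image C g) (onArr (dir_image C f) \<phi>) =
    onArr (dir_image C (g \<cdot> f)) \<phi> \<cdot>\<^bsub>disc_slice C Z\<^esub> psComp (adherence C) g f m"
proof -
  interpret D: category "disc_slice C Z" by (rule category_disc_slice)
  have gf: "g \<cdot> f \<in> hom C X Z" by (rule comp_hom [OF f g])
  have m: "m \<in> Discrete C" "Cod C m = X" and n: "n \<in> Discrete C" "Cod C n = X"
    using \<phi> by (simp_all add: hom_disc_slice)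
  have gfm: "(g \<cdot> f) \<cdot> m = g \<cdot> f \<cdot> m" "(g \<cdot> f) \<cdot> n = g \<cdot> f \<cdot> n"
    using f g m n by (simp_all add: in_hom)
  note F = dir_image_arr [OF f \<phi>]
  note GF = dir_image_arr [OF g F(1)]
  note H = dir_image_arr [OF gf \<phi>, unfolded gfm]
  note cm = comparison [OF f g m] and cn = comparison [OF f g n]
  let ?L = "psComp (adherence C) g f n \<cdot>\<^bsub>disc_slice C Z\<^esub>
    onArr (dir_image C g) (onArr (dir_image C f) \<phi>)"
  let ?R = "onArr (dir_image C (g \<cdot> f)) \<phi> \<cdot>\<^bsub>disc_slice C Z\<^esub> psComp (adherence C) g f m"
  let ?e = "reflection g (img f m) \<cdot> reflection f m"
  show "?L = ?R"
  proof (rule disc_slice_eqI [where e = ?e])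
    show "?L \<in> hom (disc_slice C Z) (img g (img f m)) (img g (f \<cdot> n))"
      by (rule D.comp_hom [OF GF(1) cn(1)])
    show "?R \<in> hom (disc_slice C Z) (img g (img f m)) (img g (f \<cdot> n))"
      by (rule D.comp_hom [OF cm(1) H(1)])
    let ?\<kappa> = "\<lambda>p. underlying (psComp (adherence C) g f p)"
    have "underlying ?L \<cdot> ?e = ?\<kappa> n \<cdot>
        underlying (onArr (dir_image C g) (onArr (dir_image C f) \<phi>)) \<cdot>
        reflection g (img f m) \<cdot> reflection f m"
      using f g m GF(1) cn(1) by (simp add: hom_disc_slice in_hom)
    also have "\<dots> = ?\<kappa> n \<cdot> reflection g (img f n) \<cdot>
        underlying (onArr (dir_image C f) \<phi>) \<cdot> reflection f m"
      using f g m n F(1) GF(1) by (simp add: comp_rewrite [OF GF(2)] hom_disc_slice in_hom)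
    also have "\<dots> = ?\<kappa> n \<cdot> reflection g (img f n) \<cdot> reflection f n \<cdot> underlying \<phi>"
      by (simp only: F(2))
    also have "\<dots> = (?\<kappa> n \<cdot> reflection g (img f n) \<cdot> reflection f n) \<cdot> underlying \<phi>"
      using f g n \<phi> cn(1) by (simp add: hom_disc_slice in_hom)
    also have "\<dots> = underlying (onArr (dir_image C (g \<cdot> f)) \<phi>) \<cdot> reflection g (f \<cdot> m)"
      by (simp only: cn(3) H(2))
    also have "\<dots> = underlying (onArr (dir_image C (g \<cdot> f)) \<phi>) \<cdot> ?\<kappa> m \<cdot> ?e"
      by (simp only: cm(3))
    also have "\<dots> = underlying ?R \<cdot> ?e"
      using f g m H(1) cm(1) by (simp add: hom_disc_slice in_hom)
    finally show "underlying ?L \<cdot> ?e = underlying ?R \<cdot> ?e" .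
  qed (use f g m in \<open>simp_all add: in_hom final_comp\<close>)
qed

text \<open>
  Along the composite of the three reflection maps both sides restrict to the single reflection map
  of \<open>h \<cdot> g \<cdot> f \<cdot> m\<close>.
\<close>

lemma comparison_assoc:
  assumes f: "f \<in> hom C X Y" and g: "g \<in> hom C Y Z" and h: "h \<in> hom C Z W"
    and m: "m \<in> Discrete C" "Cod C m = X"
  shows "psComp (adherence C) h (g \<cdot> f) m \<cdot>\<^bsub>disc_slice C W\<^esub>
      onArr (dir_image C h) (psComp (adherence C) g f m) =
    psComp (adherence C) (h \<cdot> g) f m \<cdot>\<^bsub>disc_slice C W\<^esub>
      psComp (adherence C) h g (img f m)" (is "?L = ?R")
proof -
  interpret D: category "disc_slice C W" by (rule category_disc_slice)
  let ?\<kappa> = "psComp (adherence C)"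
  have gf: "g \<cdot> f \<in> hom C X Z" and hg: "h \<cdot> g \<in> hom C Y W"
    using f g h by (auto intro: comp_hom)
  have fm: "img f m \<in> Discrete C" "Cod C (img f m) = Y"
    using f m by (simp_all add: in_hom)
  have gfm: "(g \<cdot> f) \<cdot> m = g \<cdot> f \<cdot> m" "(h \<cdot> g) \<cdot> img f m = h \<cdot> g \<cdot> img f m"
    "(h \<cdot> g) \<cdot> f \<cdot> m = h \<cdot> g \<cdot> f \<cdot> m"
    using f g h m by (simp_all add: in_hom)
  note c1 = comparison [OF f g m]
  note H = dir_image_arr [OF h c1(1)]
  note c2 = comparison [OF gf h m, unfolded gfm]
  note c3 = comparison [OF g h fm]
  note c4 = comparison [OF f hg m, unfolded gfm]
  let ?e1 = "reflection g (img f m) \<cdot> reflection f m"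
  let ?e = "reflection h (img g (img f m)) \<cdot> ?e1"
  show "?L = ?R"
  proof (rule disc_slice_eqI [where e = ?e])
    show "?L \<in> hom (disc_slice C W) (img h (img g (img f m))) (img h (g \<cdot> f \<cdot> m))"
      by (rule D.comp_hom [OF H(1) c2(1)])
    show "?R \<in> hom (disc_slice C W) (img h (img g (img f m))) (img h (g \<cdot> f \<cdot> m))"
      by (rule D.comp_hom [OF c3(1) c4(1)])
    have "underlying ?L \<cdot> ?e = underlying (?\<kappa> h (g \<cdot> f) m) \<cdot>
        underlying (onArr (dir_image C h) (?\<kappa> g f m)) \<cdot>
        reflection h (img g (img f m)) \<cdot> ?e1"
      using f g h m H(1) c2(1) by (simp add: hom_disc_slice in_hom)
    also have "\<dots> = underlying (?\<kappa> h (g \<cdot> f) m) \<cdot> reflection h (img g (f \<cdot> m)) \<cdot>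
        underlying (?\<kappa> g f m) \<cdot> ?e1"
      using f g h m H(1) c1(1) by (simp add: comp_rewrite [OF H(2)] hom_disc_slice in_hom)
    also have "\<dots> = reflection h (g \<cdot> f \<cdot> m)"
      by (simp only: c1(3) c2(3))
    also have "\<dots> = underlying (?\<kappa> (h \<cdot> g) f m) \<cdot> reflection h (g \<cdot> img f m) \<cdot> reflection f m"
      by (simp only: c4(3))
    also have "\<dots> = underlying (?\<kappa> (h \<cdot> g) f m) \<cdot> (underlying (?\<kappa> h g (img f m)) \<cdot>
        reflection h (img g (img f m)) \<cdot> reflection g (img f m)) \<cdot> reflection f m"
      by (simp only: c3(3))
    also have "\<dots> = underlying ?R \<cdot> ?e"
      using f g h m c3(1) c4(1) by (simp add: hom_disc_slice in_hom)
    finally show "underlying ?L \<cdot> ?e = underlying ?R \<cdot> ?e" .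
  qed (use f g h m in \<open>simp_all add: in_hom final_comp\<close>)
qed

lemma unit_comparison_natural:
  assumes X: "X \<in> Obj C" and \<phi>: "\<phi> \<in> hom (disc_slice C X) m n"
  shows "psUnit (adherence C) X n \<cdot>\<^bsub>disc_slice C X\<^esub> \<phi> =
    onArr (dir_image C (Ide C X)) \<phi> \<cdot>\<^bsub>disc_slice C X\<^esub> psUnit (adherence C) X m"
proof -
  have m: "m \<in> Discrete C" "Cod C m = X" and n: "n \<in> Discrete C" "Cod C n = X"
    using \<phi> by (simp_all add: hom_disc_slice)
  have "Ide C X \<cdot> m = m" "Ide C X \<cdot> n = n"
    using m n by simp_all
  note I = dir_image_arr [OF ide_hom [OF X] \<phi>, unfolded this]
  show ?thesis
    using I \<phi> unit_comparison [OF m] unit_comparison [OF n]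
    by (simp add: hom_disc_slice)
qed

lemma comparison_unit_right:
  assumes f: "f \<in> hom C X Y" and m: "m \<in> Discrete C" "Cod C m = X"
  shows "psComp (adherence C) f (Ide C X) m \<cdot>\<^bsub>disc_slice C Y\<^esub>
      onArr (dir_image C f) (psUnit (adherence C) X m) = Ide (disc_slice C Y) (img f m)"
    (is "?L = ?R")
proof -
  interpret D: category "disc_slice C Y" by (rule category_disc_slice)
  have X: "X \<in> Obj C" using f by (rule hom_obj)
  have im: "Ide C X \<cdot> m = m" using m by simp
  note u = unit_comparison [OF m]
  note F = dir_image_arr [OF f u(1)]
  note c = comparison [OF ide_hom [OF X] f m, unfolded im]
  let ?k = "underlying (psComp (adherence C) f (Ide C X) m)"
  show "?L = ?R"
  proof (rule disc_slice_eqI [where e = "reflection f m"])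
    show "?L \<in> hom (disc_slice C Y) (img f m) (img f m)"
      by (rule D.comp_hom [OF F(1) c(1)])
    show "?R \<in> hom (disc_slice C Y) (img f m) (img f m)"
      using f m D.ide_hom [of "img f m"] by (simp add: in_hom)
    have "underlying ?L \<cdot> reflection f m = ?k \<cdot>
        underlying (onArr (dir_image C f) (psUnit (adherence C) X m)) \<cdot> reflection f m"
      using f m F(1) c(1) by (simp add: hom_disc_slice in_hom)
    also have "\<dots> = ?k \<cdot> reflection f (discPart C m) \<cdot> finPart C m"
      by (simp only: F(2) u(3))
    also have "\<dots> = underlying ?R \<cdot> reflection f m"
      using f m by (simp add: c(3) in_hom)
    finally show "underlying ?L \<cdot> reflection f m = underlying ?R \<cdot> reflection f m" .
  qed (use f m in \<open>simp_all add: in_hom\<close>)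
qed

lemma comparison_unit_left:
  assumes f: "f \<in> hom C X Y" and m: "m \<in> Discrete C" "Cod C m = X"
  shows "psComp (adherence C) (Ide C Y) f m \<cdot>\<^bsub>disc_slice C Y\<^esub>
      psUnit (adherence C) Y (img f m) = Ide (disc_slice C Y) (img f m)"
    (is "?L = ?R")
proof -
  interpret D: category "disc_slice C Y" by (rule category_disc_slice)
  have Y: "Y \<in> Obj C" using f by (rule hom_obj)
  have fm: "img f m \<in> Discrete C" "Cod C (img f m) = Y"
    using f m by (simp_all add: in_hom)
  have im: "Ide C Y \<cdot> img f m = img f m" "Ide C Y \<cdot> f \<cdot> m = f \<cdot> m"
    using f m by (simp_all add: in_hom)
  note u = unit_comparison [OF fm]
  note c = comparison [OF f ide_hom [OF Y] m, unfolded im]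
  show "?L = ?R"
  proof (rule disc_slice_eqI [where e = "reflection f m"])
    show "?L \<in> hom (disc_slice C Y) (img f m) (img f m)"
      by (rule D.comp_hom [OF u(1) c(1)])
    show "?R \<in> hom (disc_slice C Y) (img f m) (img f m)"
      using f m D.ide_hom [of "img f m"] by (simp add: in_hom)
    show "underlying ?L \<cdot> reflection f m = underlying ?R \<cdot> reflection f m"
      using f m c u by (simp add: hom_disc_slice in_hom)
  qed (use f m in \<open>simp_all add: in_hom\<close>)
qed

end

text \<open>
  The comparisons in \<open>adherence\<close> make sense for arbitrary discrete spaces, not just neighborhoods.
\<close>

definition direct_images ::
    "('o, 'a, 'z) fact_cat_scheme \<Rightarrow> ('o, 'a, 'a, 'a \<times> 'a \<times> 'a) psfunct" where
  "direct_images C = (adherence C)\<lparr>psCat := disc_slice C\<rparr>"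

lemma direct_images_sel [simp]:
  "psCat (direct_images C) = disc_slice C"
  "psFun (direct_images C) = dir_image C"
  "psComp (direct_images C) = psComp (adherence C)"
  "psUnit (direct_images C) = psUnit (adherence C)"
  by (simp_all add: direct_images_def adherence_def)

context fact_system
begin

lemma pseudofunctor_direct_images: "pseudofunctor C (direct_images C)"
proof (intro pseudofunctor.intro category_axioms pseudofunctor_axioms.intro,
    unfold direct_images_sel)
  fix X assume X: "X \<in> Obj C"
  interpret D: category "disc_slice C X" by (rule category_disc_slice)
  show "nat_iso (disc_slice C X) (disc_slice C X) funct_id (dir_image C (Ide C X))
      (psUnit (adherence C) X)"
    using unit_comparison(1,2) unit_comparison_natural [OF X]
    by (intro nat_iso.intro nat_iso_axioms.intro is_funct_id D.category_axioms
        dir_image_functor ide_hom X)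
      (simp_all add: funct_id_def)
next
  fix f g X Y Z assume f: "f \<in> hom C X Y" and g: "g \<in> hom C Y Z"
  have obj: "img f m \<in> Discrete C \<and> Cod C (img f m) = Y"
    if "m \<in> Discrete C" "Cod C m = X" for m
    using that f by (simp add: in_hom)
  have "(g \<cdot> f) \<cdot> m = g \<cdot> f \<cdot> m" if "m \<in> Discrete C" "Cod C m = X" for m
    using f g that by (simp add: in_hom)
  then show "nat_iso (disc_slice C X) (disc_slice C Z) (dir_image C g \<circ>\<^sub>F dir_image C f)
      (dir_image C (g \<cdot> f)) (psComp (adherence C) g f)"
    using comparison(1,2) [OF f g] comparison_natural [OF f g]
    by (intro nat_iso.intro nat_iso_axioms.intro is_funct_comp [where B = "disc_slice C Y"]
        dir_image_functor comp_hom [OF f g] f g)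
      (simp_all add: funct_comp_def)
(* Composites in the slice must stay folded for the coherence lemmas to match. *)
qed (simp_all add: category_disc_slice dir_image_functor comparison_assoc comparison_unit_right
    comparison_unit_left del: disc_slice_ide_comp)

end


section \<open>Neighborhoods\<close>

definition is_nbhd :: "('o, 'a, 'z) fact_cat_scheme \<Rightarrow> 'o \<Rightarrow> 'a \<Rightarrow> bool" where
  "is_nbhd C X m \<longleftrightarrow> (\<exists>x \<in> hom C (One C) X. isomorphic (disc_slice C X) m (nbhd C x))"

lemma adherence_eq_restrict: "adherence C = restrict_psfunct (direct_images C) (is_nbhd C)"
  by (simp add: restrict_psfunct_def direct_images_def adherence_def adh_def [abs_def] is_nbhd_def [abs_def])

context fact_system
begin

text \<open>
  The neighborhood of \<open>x\<close> is the direct image along \<open>x\<close> of the identity of the terminal space, which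
  is discrete. Taking the canonical map from \<open>\<exists>\<^sub>f \<nu>(x)\<close> to \<open>\<nu>(f x)\<close> from the pseudo-functor of
  direct images makes its coherence a special case.
\<close>

definition nbhd_comparison :: "'a \<Rightarrow> 'a \<Rightarrow> 'a \<times> 'a \<times> 'a" where
  "nbhd_comparison f x = psComp (adherence C) f x (Ide C (One C))"

lemma nbhd_comparison:
  assumes x: "x \<in> hom C (One C) X" and f: "f \<in> hom C X Y"
  shows "nbhd_comparison f x \<in> hom (disc_slice C Y) (img f (nbhd C x)) (nbhd C (f \<cdot> x))"
    and "iso (disc_slice C Y) (nbhd_comparison f x)"
    and "underlying (nbhd_comparison f x) \<cdot> reflection f (nbhd C x) \<cdot> finPart C x = finPart C (f \<cdot> x)"
proof -
  have "x \<cdot> Ide C (One C) = x" using x by (simp add: in_hom)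
  note c = comparison [OF x f discrete_ide [OF one_obj], unfolded this]
  show "nbhd_comparison f x \<in> hom (disc_slice C Y) (img f (nbhd C x)) (nbhd C (f \<cdot> x))"
    and "iso (disc_slice C Y) (nbhd_comparison f x)"
    and "underlying (nbhd_comparison f x) \<cdot> reflection f (nbhd C x) \<cdot> finPart C x = finPart C (f \<cdot> x)"
    using c one_obj by (simp_all add: nbhd_comparison_def)
qed

lemma is_nbhd_nbhd:
  assumes x: "x \<in> hom C (One C) X"
  shows "is_nbhd C X (nbhd C x)"
proof -
  interpret D: category "disc_slice C X" by (rule category_disc_slice)
  have "nbhd C x \<in> Obj (disc_slice C X)"
    using x by (simp add: in_hom)
  then show ?thesis
    unfolding is_nbhd_def isomorphic_def
    using x D.ide_hom iso_ide [OF D.category_axioms] by blast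
qed

text \<open>
  Direct images preserve isomorphisms, and \<open>\<exists>\<^sub>f \<nu>(x)\<close> is isomorphic to \<open>\<nu>(f x)\<close>.
\<close>

lemma is_nbhd_direct_image:
  assumes f: "f \<in> hom C X Y" and m: "is_nbhd C X m"
  shows "is_nbhd C Y (img f m)"
proof -
  obtain x where x: "x \<in> hom C (One C) X" and "isomorphic (disc_slice C X) m (nbhd C x)"
    using m by (auto simp: is_nbhd_def)
  then have "isomorphic (disc_slice C Y) (img f m) (img f (nbhd C x))"
    using funct_isomorphic [OF dir_image_functor [OF f]] by (metis dir_image_obj)
  moreover have "isomorphic (disc_slice C Y) (img f (nbhd C x)) (nbhd C (f \<cdot> x))"
    using nbhd_comparison(1,2) [OF x f] by (auto simp: isomorphic_def)
  ultimately have "isomorphic (disc_slice C Y) (img f m) (nbhd C (f \<cdot> x))"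
    by (rule isomorphic_trans [OF category_disc_slice])
  then show ?thesis
    using comp_hom [OF x f] by (auto simp: is_nbhd_def)
qed

end


section \<open>The category of points and arrows\<close>

context lawvere_arrow_cat
begin

lemmas structure_homs = src_point tgt_point threeA_arrow threeB_arrow threeC_arrow
  fourA_arrow fourB_arrow fourC_arrow

definition to_one :: 'a where
  "to_one = (THE u. u \<in> hom C (Two C) (One C))"

lemma to_one: "to_one \<in> hom C (Two C) (One C)"
  unfolding to_one_def by (rule theI' [OF one_terminal [OF two_obj]])

lemma id_arrow_eq: "id_arrow C x = x \<cdot> to_one"
  by (simp add: id_arrow_def to_one_def)

lemma to_one_point: "p \<in> hom C (One C) (Two C) \<Longrightarrow> to_one \<cdot> p = Ide C (One C)"
  using one_terminal [OF one_obj] comp_hom [of p _ _ to_one, OF _ to_one] ide_hom [OF one_obj]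
  by blast

lemma id_arrow_ends:
  assumes "x \<in> hom C (One C) X"
  shows "id_arrow C x \<in> hom C (Two C) X" "id_arrow C x \<cdot> src C = x" "id_arrow C x \<cdot> tgt C = x"
  using assms to_one to_one_point [OF src_point] to_one_point [OF tgt_point] src_point tgt_point
  by (simp_all add: id_arrow_eq in_hom)

text \<open>
  Every consecutive pair of arrows is of this form, so composites can be computed from any map out of
  \<open>3\<close> without referring to the description in its definition.
\<close>

lemma arrow_comp_eq:
  assumes w: "w \<in> hom C (Three C) X"
  shows "arrow_comp C (w \<cdot> threeA C) (w \<cdot> threeB C) = w \<cdot> threeC C"
proof -
  have "(w \<cdot> threeA C) \<cdot> tgt C = (w \<cdot> threeB C) \<cdot> src C"
    using w structure_homs three_glue by (simp add: in_hom)
  then have "\<exists>!v. v \<in> hom C (Three C) X \<and> v \<cdot> threeA C = w \<cdot> threeA C \<and>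
      v \<cdot> threeB C = w \<cdot> threeB C"
    using w threeA_arrow threeB_arrow by (intro three_pushout) (auto intro: comp_hom)
  moreover have "Cod C (w \<cdot> threeA C) = X"
    using w threeA_arrow by (simp add: in_hom)
  ultimately have "(THE v. v \<in> hom C (Three C) (Cod C (w \<cdot> threeA C)) \<and>
      v \<cdot> threeA C = w \<cdot> threeA C \<and> v \<cdot> threeB C = w \<cdot> threeB C) = w"
    using w by (intro the1_equality) auto
  then show ?thesis by (simp add: arrow_comp_def)
qed

lemma consecutive_arrowsE:
  assumes "l \<in> hom C (Two C) X" "l' \<in> hom C (Two C) X" "l \<cdot> tgt C = l' \<cdot> src C"
  obtains w where "w \<in> hom C (Three C) X" "w \<cdot> threeA C = l" "w \<cdot> threeB C = l'"
    "arrow_comp C l l' = w \<cdot> threeC C"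
  using three_pushout [OF assms] arrow_comp_eq by blast

lemma arrow_comp_ends:
  assumes "l \<in> hom C (Two C) X" "l' \<in> hom C (Two C) X" "l \<cdot> tgt C = l' \<cdot> src C"
  shows "arrow_comp C l l' \<in> hom C (Two C) X"
    "arrow_comp C l l' \<cdot> src C = l \<cdot> src C" "arrow_comp C l l' \<cdot> tgt C = l' \<cdot> tgt C"
proof -
  obtain w where w: "w \<in> hom C (Three C) X" "w \<cdot> threeA C = l" "w \<cdot> threeB C = l'"
    "arrow_comp C l l' = w \<cdot> threeC C"
    by (rule consecutive_arrowsE [OF assms])
  show "arrow_comp C l l' \<in> hom C (Two C) X"
    using w threeC_arrow by (auto intro: comp_hom)
  show "arrow_comp C l l' \<cdot> src C = l \<cdot> src C" "arrow_comp C l l' \<cdot> tgt C = l' \<cdot> tgt C"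
    using w(1) structure_homs threeC_src threeC_tgt
    by (simp_all add: w(2,3) [symmetric] arrow_comp_eq [OF w(1)] in_hom)
qed

lemma map_arrow_comp:
  assumes l: "l \<in> hom C (Two C) X" "l' \<in> hom C (Two C) X" "l \<cdot> tgt C = l' \<cdot> src C"
    and f: "f \<in> hom C X Y"
  shows "f \<cdot> arrow_comp C l l' = arrow_comp C (f \<cdot> l) (f \<cdot> l')"
proof -
  obtain w where w: "w \<in> hom C (Three C) X" "w \<cdot> threeA C = l" "w \<cdot> threeB C = l'"
    "arrow_comp C l l' = w \<cdot> threeC C"
    by (rule consecutive_arrowsE [OF l])
  show ?thesis
    using arrow_comp_eq [OF comp_hom [OF w(1) f]] w(1) f structure_homs
    by (simp add: w(2,3) [symmetric] arrow_comp_eq [OF w(1)] in_hom)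
qed

text \<open>
  An arrow \<open>l\<close> is the image of the generic arrow of \<open>2\<close> under the map \<open>l\<close> itself, so the generic
  unit laws are transported along \<open>l\<close>. Associativity is transported in the same way from \<open>4\<close>.
\<close>

lemma arrow_comp_id:
  assumes l: "l \<in> hom C (Two C) X"
  shows "arrow_comp C (id_arrow C (l \<cdot> src C)) l = l"
    and "arrow_comp C l (id_arrow C (l \<cdot> tgt C)) = l"
proof -
  have id: "Ide C (Two C) \<in> hom C (Two C) (Two C)"
    using two_obj by (rule ide_hom)
  have [simp]: "l \<cdot> Ide C (Two C) = l" "Ide C (Two C) \<cdot> src C = src C" "Ide C (Two C) \<cdot> tgt C = tgt C"
    "l \<cdot> id_arrow C (src C) = id_arrow C (l \<cdot> src C)"
    "l \<cdot> id_arrow C (tgt C) = id_arrow C (l \<cdot> tgt C)"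
    using l src_point tgt_point to_one by (simp_all add: in_hom id_arrow_eq)
  show "arrow_comp C (id_arrow C (l \<cdot> src C)) l = l"
    using map_arrow_comp [OF id_arrow_ends(1) [OF src_point] id _ l] id_arrow_ends [OF src_point]
    by (simp add: unit_src)
  show "arrow_comp C l (id_arrow C (l \<cdot> tgt C)) = l"
    using map_arrow_comp [OF id id_arrow_ends(1) [OF tgt_point] _ l] id_arrow_ends [OF tgt_point]
    by (simp add: unit_tgt)
qed

lemma arrow_comp_assoc:
  assumes l: "l \<in> hom C (Two C) X" "l' \<in> hom C (Two C) X" "l'' \<in> hom C (Two C) X"
    and "l \<cdot> tgt C = l' \<cdot> src C" "l' \<cdot> tgt C = l'' \<cdot> src C"
  shows "arrow_comp C (arrow_comp C l l') l'' = arrow_comp C l (arrow_comp C l' l'')"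
proof -
  obtain w where w: "w \<in> hom C (Four C) X"
    and l_eqs [symmetric]: "w \<cdot> fourA C = l" "w \<cdot> fourB C = l'" "w \<cdot> fourC C = l''"
    using four_pushout [OF assms] by blast
  note AB = arrow_comp_ends [OF fourA_arrow fourB_arrow four_glue(1)]
  note BC = arrow_comp_ends [OF fourB_arrow fourC_arrow four_glue(2)]
  have AB_C: "arrow_comp C (fourA C) (fourB C) \<cdot> tgt C = fourC C \<cdot> src C"
    and A_BC: "fourA C \<cdot> tgt C = arrow_comp C (fourB C) (fourC C) \<cdot> src C"
    using AB BC four_glue by simp_all
  have "arrow_comp C (arrow_comp C l l') l'' =
      w \<cdot> arrow_comp C (arrow_comp C (fourA C) (fourB C)) (fourC C)"
    using map_arrow_comp [OF fourA_arrow fourB_arrow four_glue(1) w]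
      map_arrow_comp [OF AB(1) fourC_arrow AB_C w]
    by (simp add: l_eqs)
  moreover have "arrow_comp C l (arrow_comp C l' l'') =
      w \<cdot> arrow_comp C (fourA C) (arrow_comp C (fourB C) (fourC C))"
    using map_arrow_comp [OF fourB_arrow fourC_arrow four_glue(2) w]
      map_arrow_comp [OF fourA_arrow BC(1) A_BC w]
    by (simp add: l_eqs)
  ultimately show ?thesis
    by (simp add: four_assoc)
qed

lemma star_cat_sel [simp]:
  "Obj (star_cat C X) = hom C (One C) X"
  "Arr (star_cat C X) = hom C (Two C) X"
  "Dom (star_cat C X) l = l \<cdot> src C"
  "Cod (star_cat C X) l = l \<cdot> tgt C"
  "Ide (star_cat C X) = id_arrow C"
  "l' \<cdot>\<^bsub>star_cat C X\<^esub> l = arrow_comp C l l'"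
  by (simp_all add: star_cat_def)

lemma hom_star_cat:
  "l \<in> hom (star_cat C X) x y \<longleftrightarrow> l \<in> hom C (Two C) X \<and> l \<cdot> src C = x \<and> l \<cdot> tgt C = y"
  by (simp add: hom_def [of "star_cat C X"])

lemma category_star_cat: "category (star_cat C X)"
  by (rule category.intro)
    (auto simp: hom_star_cat id_arrow_ends arrow_comp_ends arrow_comp_id arrow_comp_assoc
      intro: comp_hom src_point tgt_point)

lemma star_funct_functor:
  assumes f: "f \<in> hom C X Y"
  shows "is_funct (star_cat C X) (star_cat C Y) (star_funct C f)"
proof -
  have "f \<cdot> l \<in> hom C (Two C) Y" "(f \<cdot> l) \<cdot> src C = f \<cdot> l \<cdot> src C" "(f \<cdot> l) \<cdot> tgt C = f \<cdot> l \<cdot> tgt C"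
    if "l \<in> hom C (Two C) X" for l
    using that f src_point tgt_point by (simp_all add: in_hom)
  moreover have "f \<cdot> id_arrow C x = id_arrow C (f \<cdot> x)" "f \<cdot> x \<in> hom C (One C) Y"
    if "x \<in> hom C (One C) X" for x
    using that f to_one by (simp_all add: id_arrow_eq in_hom)
  ultimately show ?thesis
    by (intro is_funct.intro category_star_cat is_funct_axioms.intro)
      (auto simp: star_funct_def hom_star_cat map_arrow_comp [OF _ _ _ f])
qed

lemma pseudofunctor_star: "pseudofunctor C (star C)"
  unfolding star_def
  by (intro pseudofunctor_strict category_axioms category_star_cat star_funct_functor)
    (simp_all add: star_funct_def in_hom)


section \<open>Displacements along arrows\<close>

lemma orth_tgt_discrete: "m \<in> Discrete C \<Longrightarrow> orth C (tgt C) m"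
  using tgt_generates by blast

lemma lift_arrow:
  assumes m: "m \<in> Discrete C" and l: "l \<in> hom C (Two C) (Cod C m)"
    and a: "a \<in> hom C (One C) (Dom C m)" and "m \<cdot> a = l \<cdot> tgt C"
  shows "\<exists>!u. u \<in> hom C (Two C) (Dom C m) \<and> m \<cdot> u = l \<and> u \<cdot> tgt C = a"
  using orth_fill [OF orth_tgt_discrete [OF m], of a l] assms tgt_point
  by (simp add: in_hom conj_ac)

lemma lift_to_nbhd:
  assumes l: "l \<in> hom C (Two C) X"
  shows "\<exists>!u. u \<in> hom C (Two C) (Dom C (nbhd C (l \<cdot> tgt C))) \<and> nbhd C (l \<cdot> tgt C) \<cdot> u = l \<and>
    u \<cdot> tgt C = finPart C (l \<cdot> tgt C)"
  using l tgt_point by (intro lift_arrow) (simp_all add: in_hom)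

lemma star_to_adh_obj [simp]: "onObj (star_to_adh C X) x = nbhd C x"
  by (simp add: star_to_adh_def)

text \<open>
  Stated for any arrow with the properties of the lifting: by uniqueness it is the lifting, so a
  displacement is computed by exhibiting a suitable arrow.
\<close>

lemma displacement:
  assumes l: "l \<in> hom C (Two C) X"
    and u: "u \<in> hom C (Two C) (Dom C (nbhd C (l \<cdot> tgt C)))" "nbhd C (l \<cdot> tgt C) \<cdot> u = l"
      "u \<cdot> tgt C = finPart C (l \<cdot> tgt C)"
  shows "onArr (star_to_adh C X) l \<in>
      hom (disc_slice C X) (nbhd C (l \<cdot> src C)) (nbhd C (l \<cdot> tgt C))"
    and "underlying (onArr (star_to_adh C X) l) \<cdot> finPart C (l \<cdot> src C) = u \<cdot> src C"
proof -
  let ?x = "l \<cdot> src C" and ?y = "l \<cdot> tgt C"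
  define k where "k = final_ext C (finPart C ?x) (nbhd C ?x) (nbhd C ?y) (u \<cdot> src C)"
  have "lifting C (nbhd C ?y) l (finPart C ?y) = u"
    unfolding lifting_def using u by (intro the1_equality lift_to_nbhd [OF l]) auto
  then have eq: "onArr (star_to_adh C X) l = (nbhd C ?x, k, nbhd C ?y)"
    by (simp add: star_to_adh_def Let_def k_def refl_ext_def final_ext_def)
  have xy: "?x \<in> Arr C" "Cod C ?x = X" "Dom C ?x = One C" "?y \<in> Arr C" "Cod C ?y = X"
    using l src_point tgt_point by (simp_all add: in_hom)
  moreover have "nbhd C ?y \<cdot> u \<cdot> src C = l \<cdot> src C"
    using xy u(1) src_point comp_rewrite [OF u(2), of "src C"] by (simp add: in_hom)
  ultimately have "k \<in> hom C (Dom C (nbhd C ?x)) (Dom C (nbhd C ?y))" "nbhd C ?y \<cdot> k = nbhd C ?x"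
    "k \<cdot> finPart C ?x = u \<cdot> src C"
    using u(1) src_point unfolding k_def by (intro final_ext; simp add: in_hom)+
  with xy show "onArr (star_to_adh C X) l \<in> hom (disc_slice C X) (nbhd C ?x) (nbhd C ?y)"
    and "underlying (onArr (star_to_adh C X) l) \<cdot> finPart C ?x = u \<cdot> src C"
    by (simp_all add: eq hom_disc_slice in_hom)
qed

lemma star_to_adh_hom:
  assumes "l \<in> hom C (Two C) X"
  shows "onArr (star_to_adh C X) l \<in>
    hom (disc_slice C X) (nbhd C (l \<cdot> src C)) (nbhd C (l \<cdot> tgt C))"
  using lift_to_nbhd [OF assms] displacement(1) [OF assms] by blast


lemma star_to_adh_functor: "is_funct (star_cat C X) (disc_slice C X) (star_to_adh C X)"
proof (intro is_funct.intro category_star_cat category_disc_slice is_funct_axioms.intro)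
  fix x assume "x \<in> Obj (star_cat C X)"
  then show "onObj (star_to_adh C X) x \<in> Obj (disc_slice C X)"
    by (simp add: in_hom)
next
  fix l x y assume "l \<in> hom (star_cat C X) x y"
  then show "onArr (star_to_adh C X) l \<in>
      hom (disc_slice C X) (onObj (star_to_adh C X) x) (onObj (star_to_adh C X) y)"
    using star_to_adh_hom [of l X] by (simp add: hom_star_cat)
next
  interpret D: category "disc_slice C X" by (rule category_disc_slice)
  fix x assume "x \<in> Obj (star_cat C X)"
  then have x: "x \<in> hom C (One C) X" by simp
  note id = id_arrow_ends [OF x]
  have "finPart C x \<in> hom C (One C) (Dom C (nbhd C x))"
    using x by (simp add: in_hom)
  note u = id_arrow_ends [OF this]
  \<comment> \<open>The constant arrow at the final point lies over the identity arrow of \<open>x\<close>.\<close>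
  have "nbhd C x \<cdot> id_arrow C (finPart C x) = id_arrow C x"
    using x to_one by (simp add: id_arrow_eq in_hom)
  with id u have d: "onArr (star_to_adh C X) (id_arrow C x) \<in> hom (disc_slice C X) (nbhd C x) (nbhd C x)"
    "underlying (onArr (star_to_adh C X) (id_arrow C x)) \<cdot> finPart C x = finPart C x"
    using displacement [OF id(1), of "id_arrow C (finPart C x)"] by simp_all
  show "onArr (star_to_adh C X) (Ide (star_cat C X) x) =
      Ide (disc_slice C X) (onObj (star_to_adh C X) x)"
  proof (rule disc_slice_eqI [where e = "finPart C x"])
    show "onArr (star_to_adh C X) (Ide (star_cat C X) x) \<in> hom (disc_slice C X) (nbhd C x) (nbhd C x)"
      using d by simp
    show "Ide (disc_slice C X) (onObj (star_to_adh C X) x) \<in> hom (disc_slice C X) (nbhd C x) (nbhd C x)"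
      using x D.ide_hom [of "nbhd C x"] by (simp add: in_hom)
  qed (use x d in \<open>simp_all add: in_hom\<close>)
next
  interpret D: category "disc_slice C X" by (rule category_disc_slice)
  fix l x y l' z
  assume "l \<in> hom (star_cat C X) x y" "l' \<in> hom (star_cat C X) y z"
  then have l: "l \<in> hom C (Two C) X" "l \<cdot> src C = x" "l \<cdot> tgt C = y"
    and l': "l' \<in> hom C (Two C) X" "l' \<cdot> src C = y" "l' \<cdot> tgt C = z"
    by (simp_all add: hom_star_cat)
  then have seq: "l \<cdot> tgt C = l' \<cdot> src C" by simp
  note ll' = arrow_comp_ends [OF l(1) l'(1) seq]
  have x: "x \<in> hom C (One C) X" and y: "y \<in> hom C (One C) X" and z: "z \<in> hom C (One C) X"
    using l l' src_point tgt_point by (auto intro: comp_hom)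
  obtain u where u: "u \<in> hom C (Two C) (Dom C (nbhd C y))" "nbhd C y \<cdot> u = l" "u \<cdot> tgt C = finPart C y"
    using lift_to_nbhd [OF l(1)] l by auto
  obtain u' where u': "u' \<in> hom C (Two C) (Dom C (nbhd C z))" "nbhd C z \<cdot> u' = l'" "u' \<cdot> tgt C = finPart C z"
    using lift_to_nbhd [OF l'(1)] l' by auto
  let ?\<phi> = "onArr (star_to_adh C X) l" and ?\<psi> = "onArr (star_to_adh C X) l'"
  have \<phi>: "?\<phi> \<in> hom (disc_slice C X) (nbhd C x) (nbhd C y)" "underlying ?\<phi> \<cdot> finPart C x = u \<cdot> src C"
    using displacement [OF l(1), of u] u l by simp_all
  have \<psi>: "?\<psi> \<in> hom (disc_slice C X) (nbhd C y) (nbhd C z)" "underlying ?\<psi> \<cdot> finPart C y = u' \<cdot> src C"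
    using displacement [OF l'(1), of u'] u' l' by simp_all
  \<comment> \<open>Carried into \<open>\<nu>(z)\<close> by \<open>?\<psi>\<close>, the lifting of \<open>l\<close> ends where the lifting of \<open>l'\<close> starts; their
    composite in the total space of \<open>\<nu>(z)\<close> is then the lifting of the composite of \<open>l\<close> and \<open>l'\<close>.\<close>
  let ?v = "underlying ?\<psi> \<cdot> u"
  have v: "?v \<in> hom C (Two C) (Dom C (nbhd C z))" "nbhd C z \<cdot> ?v = l"
    using \<psi>(1) u comp_rewrite [of "nbhd C z" "underlying ?\<psi>" "nbhd C y" u]
    by (simp_all add: hom_disc_slice in_hom)
  have v_ends: "?v \<cdot> src C = underlying ?\<psi> \<cdot> underlying ?\<phi> \<cdot> finPart C x" "?v \<cdot> tgt C = u' \<cdot> src C"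
    using \<phi> \<psi> u src_point tgt_point by (simp_all add: hom_disc_slice in_hom)
  note vu' = arrow_comp_ends [OF v(1) u'(1) v_ends(2)]
  have "nbhd C z \<in> hom C (Dom C (nbhd C z)) X"
    using z by (simp add: in_hom)
  then have "nbhd C z \<cdot> arrow_comp C ?v u' = arrow_comp C l l'"
    using map_arrow_comp [OF v(1) u'(1) v_ends(2)] v u' by simp
  then have d: "onArr (star_to_adh C X) (arrow_comp C l l') \<in> hom (disc_slice C X) (nbhd C x) (nbhd C z)"
    "underlying (onArr (star_to_adh C X) (arrow_comp C l l')) \<cdot> finPart C x =
      underlying ?\<psi> \<cdot> underlying ?\<phi> \<cdot> finPart C x"
    using displacement [OF ll'(1), of "arrow_comp C ?v u'"] ll' l l' vu' u' v_ends by simp_all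
  show "onArr (star_to_adh C X) (l' \<cdot>\<^bsub>star_cat C X\<^esub> l) = ?\<psi> \<cdot>\<^bsub>disc_slice C X\<^esub> ?\<phi>"
  proof (rule disc_slice_eqI [where e = "finPart C x"])
    show "?\<psi> \<cdot>\<^bsub>disc_slice C X\<^esub> ?\<phi> \<in> hom (disc_slice C X) (nbhd C x) (nbhd C z)"
      by (rule D.comp_hom [OF \<phi>(1) \<psi>(1)])
    show "onArr (star_to_adh C X) (l' \<cdot>\<^bsub>star_cat C X\<^esub> l) \<in> hom (disc_slice C X) (nbhd C x) (nbhd C z)"
      using d by simp
  qed (use x d \<phi>(1) \<psi>(1) in \<open>simp_all add: hom_disc_slice in_hom\<close>)
qed


section \<open>Pseudo-naturality\<close>

text \<open>
  The map from the total space of \<open>\<nu>(y)\<close> through \<open>\<exists>\<^sub>f \<nu>(y)\<close> to that of \<open>\<nu>(f y)\<close> lies over \<open>f\<close> and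
  preserves final points, hence takes the lifting of \<open>l\<close> to the lifting of \<open>f \<cdot> l\<close>. Both sides then
  have the same displacement, the source of that lifting.
\<close>

lemma nbhd_comparison_natural:
  assumes l: "l \<in> hom C (Two C) X" and f: "f \<in> hom C X Y"
  shows "nbhd_comparison f (l \<cdot> tgt C) \<cdot>\<^bsub>disc_slice C Y\<^esub>
      onArr (dir_image C f) (onArr (star_to_adh C X) l) =
    onArr (star_to_adh C Y) (f \<cdot> l) \<cdot>\<^bsub>disc_slice C Y\<^esub> nbhd_comparison f (l \<cdot> src C)"
proof -
  interpret D: category "disc_slice C Y" by (rule category_disc_slice)
  define x where "x = l \<cdot> src C"
  define y where "y = l \<cdot> tgt C"
  let ?\<phi> = "onArr (star_to_adh C X) l"
  let ?k = "underlying (nbhd_comparison f y)"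
  have x: "x \<in> hom C (One C) X" and y: "y \<in> hom C (One C) X"
    using l src_point tgt_point unfolding x_def y_def by (auto intro: comp_hom)
  have fl: "f \<cdot> l \<in> hom C (Two C) Y" "(f \<cdot> l) \<cdot> src C = f \<cdot> x" "(f \<cdot> l) \<cdot> tgt C = f \<cdot> y"
    using l f src_point tgt_point by (simp_all add: x_def y_def in_hom)
  obtain u where u: "u \<in> hom C (Two C) (Dom C (nbhd C y))" "nbhd C y \<cdot> u = l" "u \<cdot> tgt C = finPart C y"
    using lift_to_nbhd [OF l] by (auto simp: y_def)
  note \<phi> = displacement [OF l u [unfolded y_def], folded x_def y_def]
  note F = dir_image_arr [OF f \<phi>(1)]
  note cx = nbhd_comparison [OF x f] and cy = nbhd_comparison [OF y f]
  let ?v = "?k \<cdot> reflection f (nbhd C y) \<cdot> u"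
  have v: "?v \<in> hom C (Two C) (Dom C (nbhd C (f \<cdot> y)))" "nbhd C (f \<cdot> y) \<cdot> ?v = f \<cdot> l"
    "?v \<cdot> tgt C = finPart C (f \<cdot> y)"
    using f y u cy tgt_point
      comp_rewrite [of "nbhd C (f \<cdot> y)" ?k "img f (nbhd C y)" "reflection f (nbhd C y) \<cdot> u"]
    by (simp_all add: hom_disc_slice in_hom)
  note d = displacement [OF fl(1), of ?v, unfolded fl(2,3), OF v]
  show ?thesis
    unfolding x_def [symmetric] y_def [symmetric]
  proof (rule disc_slice_eqI [where e = "reflection f (nbhd C x) \<cdot> finPart C x"])
    show "nbhd_comparison f y \<cdot>\<^bsub>disc_slice C Y\<^esub> onArr (dir_image C f) ?\<phi> \<in>
        hom (disc_slice C Y) (img f (nbhd C x)) (nbhd C (f \<cdot> y))"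
      by (rule D.comp_hom [OF F(1) cy(1)])
    show "onArr (star_to_adh C Y) (f \<cdot> l) \<cdot>\<^bsub>disc_slice C Y\<^esub> nbhd_comparison f x \<in>
        hom (disc_slice C Y) (img f (nbhd C x)) (nbhd C (f \<cdot> y))"
      by (rule D.comp_hom [OF cx(1) d(1)])
    have "underlying (nbhd_comparison f y \<cdot>\<^bsub>disc_slice C Y\<^esub> onArr (dir_image C f) ?\<phi>) \<cdot>
        reflection f (nbhd C x) \<cdot> finPart C x =
        ?k \<cdot> underlying (onArr (dir_image C f) ?\<phi>) \<cdot> reflection f (nbhd C x) \<cdot> finPart C x"
      using f x F(1) cy(1) by (simp add: hom_disc_slice in_hom)
    also have "\<dots> = ?k \<cdot> reflection f (nbhd C y) \<cdot> underlying ?\<phi> \<cdot> finPart C x"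
      using f x y F(1) \<phi>(1) by (simp add: comp_rewrite [OF F(2)] hom_disc_slice in_hom)
    also have "\<dots> = ?v \<cdot> src C"
      using f y u cy(1) src_point by (simp add: \<phi>(2) hom_disc_slice in_hom)
    also have "\<dots> = underlying (onArr (star_to_adh C Y) (f \<cdot> l)) \<cdot> underlying (nbhd_comparison f x) \<cdot>
        reflection f (nbhd C x) \<cdot> finPart C x"
      by (simp only: d(2) cx(3))
    also have "\<dots> = underlying (onArr (star_to_adh C Y) (f \<cdot> l) \<cdot>\<^bsub>disc_slice C Y\<^esub> nbhd_comparison f x) \<cdot>
        reflection f (nbhd C x) \<cdot> finPart C x"
      using f x cx(1) d(1) by (simp add: hom_disc_slice in_hom)
    finally show "underlying (nbhd_comparison f y \<cdot>\<^bsub>disc_slice C Y\<^esub> onArr (dir_image C f) ?\<phi>) \<cdot>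
        reflection f (nbhd C x) \<cdot> finPart C x =
      underlying (onArr (star_to_adh C Y) (f \<cdot> l) \<cdot>\<^bsub>disc_slice C Y\<^esub> nbhd_comparison f x) \<cdot>
        reflection f (nbhd C x) \<cdot> finPart C x" .
  qed (use f x in \<open>simp_all add: in_hom final_comp\<close>)
qed

lemma star_sel [simp]:
  "psCat (star C) = star_cat C"
  "psFun (star C) = star_funct C"
  "psComp (star C) g f x = id_arrow C ((g \<cdot> f) \<cdot> x)"
  "psUnit (star C) X x = id_arrow C x"
  by (simp_all add: star_def strict_psfunct_def star_funct_def)

lemma star_funct_sel [simp]:
  "onObj (star_funct C f) x = f \<cdot> x"
  "onArr (star_funct C f) l = f \<cdot> l"
  by (simp_all add: star_funct_def)

lemma pseudonatural_direct_images:
  "pseudonatural C (star C) (direct_images C) (star_to_adh C) nbhd_comparison"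
proof (intro pseudonatural.intro pseudofunctor_star pseudofunctor_direct_images
    pseudonatural_axioms.intro, unfold star_sel direct_images_sel)
  fix X show "is_funct (star_cat C X) (disc_slice C X) (star_to_adh C X)"
    by (rule star_to_adh_functor)
next
  fix f X Y assume f: "f \<in> hom C X Y"
  show "nat_iso (star_cat C X) (disc_slice C Y) (dir_image C f \<circ>\<^sub>F star_to_adh C X)
      (star_to_adh C Y \<circ>\<^sub>F star_funct C f) (nbhd_comparison f)"
    using nbhd_comparison [OF _ f] nbhd_comparison_natural [OF _ f]
    by (intro nat_iso.intro nat_iso_axioms.intro is_funct_comp [OF star_to_adh_functor]
        is_funct_comp [OF star_funct_functor [OF f]] dir_image_functor star_to_adh_functor f)
      (auto simp: funct_comp_def hom_star_cat simp del: disc_slice_ide_comp)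
next
  fix f g X Y Z x
  assume f: "f \<in> hom C X Y" and g: "g \<in> hom C Y Z" and "x \<in> Obj (star_cat C X)"
  then have x: "x \<in> hom C (One C) X" by simp
  interpret D: category "disc_slice C Z" by (rule category_disc_slice)
  interpret \<eta>: is_funct "star_cat C Z" "disc_slice C Z" "star_to_adh C Z"
    by (rule star_to_adh_functor)
  have eq: "x \<cdot> Ide C (One C) = x" "(g \<cdot> f) \<cdot> x = g \<cdot> f \<cdot> x" and "f \<cdot> x \<in> hom C (One C) Y"
    "g \<cdot> f \<cdot> x \<in> hom C (One C) Z"
    using f g x by (simp_all add: in_hom)
  moreover from this have "onArr (star_to_adh C Z) (id_arrow C (g \<cdot> f \<cdot> x)) =
      Ide (disc_slice C Z) (nbhd C (g \<cdot> f \<cdot> x))"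
    using \<eta>.funct_ide [of "g \<cdot> f \<cdot> x"] by simp
  moreover have "nbhd_comparison (g \<cdot> f) x \<cdot>\<^bsub>disc_slice C Z\<^esub> psComp (adherence C) g f (nbhd C x) =
      nbhd_comparison g (f \<cdot> x) \<cdot>\<^bsub>disc_slice C Z\<^esub> onArr (dir_image C g) (nbhd_comparison f x)"
    using comparison_assoc [OF x f g discrete_ide [OF one_obj]] one_obj
    by (simp add: nbhd_comparison_def eq(1) del: disc_slice_ide_comp)
  moreover have "nbhd_comparison g (f \<cdot> x) \<cdot>\<^bsub>disc_slice C Z\<^esub>
      onArr (dir_image C g) (nbhd_comparison f x) \<in>
      hom (disc_slice C Z) (img g (img f (nbhd C x))) (nbhd C (g \<cdot> f \<cdot> x))"
    by (rule D.comp_hom [OF dir_image_arr(1) [OF g nbhd_comparison(1) [OF x f]]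
          nbhd_comparison(1) [OF \<open>f \<cdot> x \<in> hom C (One C) Y\<close> g]])
  ultimately show "nbhd_comparison (g \<cdot> f) x \<cdot>\<^bsub>disc_slice C Z\<^esub>
      psComp (adherence C) g f (onObj (star_to_adh C X) x) =
      onArr (star_to_adh C Z) (id_arrow C ((g \<cdot> f) \<cdot> x)) \<cdot>\<^bsub>disc_slice C Z\<^esub>
      nbhd_comparison g (onObj (star_funct C f) x) \<cdot>\<^bsub>disc_slice C Z\<^esub>
      onArr (dir_image C g) (nbhd_comparison f x)"
    using D.ide_comp by (simp del: disc_slice_ide_comp)
next
  fix X x assume X: "X \<in> Obj C" and "x \<in> Obj (star_cat C X)"
  then have x: "x \<in> hom C (One C) X" by simp
  interpret \<eta>: is_funct "star_cat C X" "disc_slice C X" "star_to_adh C X"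
    by (rule star_to_adh_functor)
  have "x \<cdot> Ide C (One C) = x" using x by (simp add: in_hom)
  then have "nbhd_comparison (Ide C X) x \<cdot>\<^bsub>disc_slice C X\<^esub> psUnit (adherence C) X (nbhd C x) =
      Ide (disc_slice C X) (nbhd C x)"
    using comparison_unit_left [OF x discrete_ide [OF one_obj]] one_obj
    by (simp add: nbhd_comparison_def del: disc_slice_ide_comp)
  then show "nbhd_comparison (Ide C X) x \<cdot>\<^bsub>disc_slice C X\<^esub>
      psUnit (adherence C) X (onObj (star_to_adh C X) x) =
      onArr (star_to_adh C X) (id_arrow C x)"
    using \<eta>.funct_ide [of x] x by (simp del: disc_slice_ide_comp)
qed

end

theorem proposition7p6:
  fixes C :: "('o, 'a) arrow_cat"
  assumes "lawvere_arrow_cat C"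
  shows "\<exists>\<tau>. pseudonatural C (star C) (adherence C) (star_to_adh C) \<tau>"
proof -
  interpret lawvere_arrow_cat C by fact
  have "pseudonatural C (star C) (restrict_psfunct (direct_images C) (is_nbhd C))
      (star_to_adh C) nbhd_comparison"
    by (rule pseudonatural_restrict [OF pseudonatural_direct_images])
      (simp_all add: is_nbhd_direct_image is_nbhd_nbhd)
  then show ?thesis
    unfolding adherence_eq_restrict by blast
qed

end
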